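(* Let $I$ be an interval of $\mathbb{R}$ and $m$ a Radon measure on $I$ with $\operatorname{supp}(m)=I$. Let $(\mathcal{E}',\mathcal{F}')$ and $(\mathcal{E},\mathcal{F})$ be two local irreducible regular Dirichlet spaces on $L^2(I,m)$, represented as $$(\mathcal{E},\mathcal{F})=(\mathcal{E}_0^{(\mathtt{s}_1,m,k_1)},\mathcal{F}_0^{(\mathtt{s}_1,m,k_1)}),\qquad (\mathcal{E}',\mathcal{F}')=(\mathcal{E}_0^{(\mathtt{s}_2,m,k_2)},\mathcal{F}_0^{(\mathtt{s}_2,m,k_2)}),$$ where $\mathtt{s}_1,\mathtt{s}_2$ are strictly increasing continuous functions on $I$ and $k_1,k_2$ are Radon measures on $I$. Then $(\mathcal{E}',\mathcal{F}')$ is a regular subspace of $(\mathcal{E},\mathcal{F})$ if and only if (1) $k_1=k_2$, and (2) $d\mathtt{s}_2$ is absolutely continuous with respect to $d\mathtt{s}_1$ and the density $d\mathtt{s}_2/d\mathtt{s}_1$ is either $1$ or $0$ a.e. with respect to $d\mathtt{s}_1$.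
   Context: $I=\langle a_1,a_2\rangle$ is a (non-degenerate) interval with end-points $a_1<a_2$, each of which may or may not belong to $I$ and may be infinite. For a strictly increasing continuous function $\mathtt{s}$ on $I$ and Radon measures $m,k$ on $I$ with $\operatorname{supp}(m)=I$, define $$\mathcal{F}^{(\mathtt{s},m,k)}=\Big\{u\in L^2(I,m+k):\ u\ll\mathtt{s}\ \text{and}\ \tfrac{du}{d\mathtt{s}}\in L^2(I,d\mathtt{s})\Big\},$$ $$\mathcal{E}^{(\mathtt{s},m,k)}(u,v)=\int_I\frac{du}{d\mathtt{s}}\frac{dv}{d\mathtt{s}}\,d\mathtt{s}+\int_I u(x)v(x)\,k(dx),$$ where $u\ll\mathtt{s}$ means that $u$ is (locally) absolutely continuous with respect to $\mathtt{s}$, i.e. $u(y)-u(x)=\int_x^y g\,d\mathtt{s}$ for all $x<y$ in $I$ for some locally $d\mathtt{s}$-integrable $g=:du/d\mathtt{s}$. The end-point $a_1$ is called a regular boundary if $a_1\notin I$, $\mathtt{s}(a_1):=\lim_{x\downarrow a_1}\mathtt{s}(x)>-\infty$ and $m((a_1,c))+k((a_1,c))<\infty$ for some $c\in I$; regularity of $a_2$ is defined similarly ($a_2\notin I$, $\mathtt{s}(a_2)<\infty$, $m((c,a_2))+k((c,a_2))<\infty$ for some $c\in I$). Then $$\mathcal{F}_0^{(\mathtt{s},m,k)}=\{u\in\mathcal{F}^{(\mathtt{s},m,k)}:\ u(a_i)=0\ \text{if}\ a_i\ \text{is a regular boundary}\},$$ with $u(a_i)$ understood as the limit at $a_i$,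 and $\mathcal{E}_0^{(\mathtt{s},m,k)}$ is the restriction of $\mathcal{E}^{(\mathtt{s},m,k)}$ to $\mathcal{F}_0^{(\mathtt{s},m,k)}$. A local regular Dirichlet space on $L^2(I,m)$ is called irreducible when its associated $m$-symmetric Hunt process $(X_t,\mathbf{P}^x)$ on $I$ is a diffusion (continuous paths up to its lifetime) with $\mathbf{P}^x(T_y<\infty)>0$ for all $x,y\in I$, $T_y$ being the hitting time of $y$. Every local irreducible regular Dirichlet space on $L^2(I,m)$ is of the form $(\mathcal{E}_0^{(\mathtt{s},m,k)},\mathcal{F}_0^{(\mathtt{s},m,k)})$ for some such $\mathtt{s}$ and $k$. Given two irreducible regular Dirichlet spaces $(\mathcal{E}',\mathcal{F}')$ and $(\mathcal{E},\mathcal{F})$ on $L^2(I,m)$, $(\mathcal{E}',\mathcal{F}')$ is called a regular subspace of $(\mathcal{E},\mathcal{F})$ if $\mathcal{F}'\subset\mathcal{F}$ and $\mathcal{E}(u,v)=\mathcal{E}'(u,v)$ for all $u,v\in\mathcal{F}'$. For a strictly increasing continuous $\mathtt{s}$, $d\mathtt{s}$ denotes the associated Lebesgue–Stieltjes measure on $I$. *)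

theory Defs
  imports "HOL-Probability.Probability"
begin

section \<open>Radon measures and Stieltjes measures on an interval\<close>

text \<open>
  Measures on \<open>I\<close> live on the Borel \<open>\<sigma>\<close>-algebra of \<open>I\<close>. As \<open>I\<close> is locally compact and second
  countable, finiteness on compact sets already implies inner and outer regularity.
\<close>

definition radon_measure_on :: "real set \<Rightarrow> real measure \<Rightarrow> bool" where
  "radon_measure_on I \<mu> \<longleftrightarrow>
     sets \<mu> = sets (restrict_space borel I) \<and>
     (\<forall>K. compact K \<and> K \<subseteq> I \<longrightarrow> emeasure \<mu> K < \<infinity>)"

definition msupport :: "real set \<Rightarrow> real measure \<Rightarrow> real set" where
  "msupport I \<mu> = {x \<in> I. \<forall>U. open U \<and> x \<in> U \<longrightarrow> 0 < emeasure \<mu> (U \<inter> I)}"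

definition add_measure :: "'a measure \<Rightarrow> 'a measure \<Rightarrow> 'a measure" where
  "add_measure \<mu> \<nu> = measure_of (space \<mu>) (sets \<mu>) (\<lambda>A. emeasure \<mu> A + emeasure \<nu> A)"

lemma sets_add_measure [simp]: "sets (add_measure \<mu> \<nu>) = sets \<mu>"
  and space_add_measure [simp]: "space (add_measure \<mu> \<nu>) = space \<mu>"
  by (simp_all add: add_measure_def)

lemma emeasure_add_measure:
  assumes "sets \<nu> = sets \<mu>" "A \<in> sets \<mu>"
  shows "emeasure (add_measure \<mu> \<nu>) A = emeasure \<mu> A + emeasure \<nu> A"
proof (rule emeasure_measure_of[OF add_measure_def])
  show "countably_additive (sets (add_measure \<mu> \<nu>)) (\<lambda>A. emeasure \<mu> A + emeasure \<nu> A)"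
  proof (rule countably_additiveI)
    fix B :: "nat \<Rightarrow> 'a set"
    assume B: "range B \<subseteq> sets (add_measure \<mu> \<nu>)" "disjoint_family B"
    have "(\<Sum>i. emeasure \<mu> (B i) + emeasure \<nu> (B i)) =
          (\<Sum>i. emeasure \<mu> (B i)) + (\<Sum>i. emeasure \<nu> (B i))"
      by (simp add: suminf_add)
    also have "\<dots> = emeasure \<mu> (\<Union> (range B)) + emeasure \<nu> (\<Union> (range B))"
      using B assms(1) by (simp add: suminf_emeasure)
    finally show "(\<Sum>i. emeasure \<mu> (B i) + emeasure \<nu> (B i)) =
      emeasure \<mu> (\<Union> (range B)) + emeasure \<nu> (\<Union> (range B))" .
  qed
  show "positive (sets (add_measure \<mu> \<nu>)) (\<lambda>A. emeasure \<mu> A + emeasure \<nu> A)"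
    by (simp add: positive_def)
  show "sets \<mu> \<subseteq> Pow (space \<mu>)" by (rule sets.space_closed)
  show "A \<in> sets (add_measure \<mu> \<nu>)" using assms(2) by simp
qed

text \<open>
  The measure \<open>ds\<close> on \<open>I\<close>. It is generated by compact intervals, unlike \<^const>\<open>interval_measure\<close>:
  \<open>s\<close> is only given on \<open>I\<close> and may be unbounded at an end-point that is not in \<open>I\<close>.
\<close>

definition stieltjes :: "real set \<Rightarrow> (real \<Rightarrow> real) \<Rightarrow> real measure" where
  "stieltjes I s =
     extend_measure I {(a, b). a \<in> I \<and> b \<in> I \<and> a \<le> b}
       (\<lambda>(a, b). {a..b}) (\<lambda>(a, b). ennreal (s b - s a))"

lemma interval_countable_Union_Icc:
  fixes J :: "real set"
  assumes J: "is_interval J"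
  defines "D \<equiv> J \<inter> (\<rat> \<union> {Inf J, Sup J})"
  shows "countable D" "D \<subseteq> J" "J = (\<Union>p\<in>D. \<Union>q\<in>D. {p..q})"
proof -
  show "countable D" "D \<subseteq> J"
    by (auto simp: D_def intro: countable_rat)
  have mem: "z \<in> J" if "x \<in> J" "y \<in> J" "x \<le> z" "z \<le> y" for x y z
    using mem_is_interval_1_I[OF J that] .
  show "J = (\<Union>p\<in>D. \<Union>q\<in>D. {p..q})"
  proof (intro equalityI subsetI)
    fix x assume x: "x \<in> J"
    have "\<exists>p\<in>D. p \<le> x"
    proof (cases "\<exists>y\<in>J. y < x")
      case True
      then obtain y where y: "y \<in> J" "y < x" by blast
      obtain r where "r \<in> \<rat>" "y < r" "r < x" using Rats_dense_in_real[OF y(2)] by blast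
      with mem[OF y(1) x, of r] show ?thesis by (auto simp: D_def intro!: bexI[of _ r])
    next
      case False
      then have "Inf J = x" using x by (intro cInf_eq_minimum) (auto simp: not_less)
      with x show ?thesis by (auto simp: D_def)
    qed
    moreover have "\<exists>p\<in>D. x \<le> p"
    proof (cases "\<exists>y\<in>J. x < y")
      case True
      then obtain y where y: "y \<in> J" "x < y" by blast
      obtain r where "r \<in> \<rat>" "x < r" "r < y" using Rats_dense_in_real[OF y(2)] by blast
      with mem[OF x y(1), of r] show ?thesis by (auto simp: D_def intro!: bexI[of _ r])
    next
      case False
      then have "Sup J = x" using x by (intro cSup_eq_maximum) (auto simp: not_less)
      with x show ?thesis by (auto simp: D_def)
    qed
    ultimately show "x \<in> (\<Union>p\<in>D. \<Union>q\<in>D. {p..q})" by auto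
  next
    fix x assume "x \<in> (\<Union>p\<in>D. \<Union>q\<in>D. {p..q})"
    then show "x \<in> J" by (auto simp: D_def intro: mem)
  qed
qed

lemma interval_Icc_subset:
  fixes I :: "real set"
  assumes "is_interval I" "a \<in> I" "b \<in> I"
  shows "{a..b} \<subseteq> I"
  using mem_is_interval_1_I[OF assms] by auto

lemma space_stieltjes:
  assumes "is_interval I"
  shows "space (stieltjes I s) = I"
proof -
  have "(\<lambda>(a, b). {a..b}) ` {(a, b). a \<in> I \<and> b \<in> I \<and> a \<le> b} \<subseteq> Pow I"
    using interval_Icc_subset[OF assms] by auto
  then show ?thesis unfolding stieltjes_def by (rule space_extend_measure)
qed

lemma sets_stieltjes [simp]:
  assumes I: "is_interval I"
  shows "sets (stieltjes I s) = sets (restrict_space borel I)"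
proof -
  let ?G = "(\<lambda>(a, b). {a..b}) ` {(a, b). a \<in> I \<and> b \<in> I \<and> a \<le> b}"
  have Icc: "{a..b} \<subseteq> I" if "a \<in> I" "b \<in> I" for a b
    using interval_Icc_subset[OF I that] .
  then have sub: "?G \<subseteq> Pow I" by auto
  have eq: "sets (stieltjes I s) = sigma_sets I ?G"
    unfolding stieltjes_def using sub by (rule sets_extend_measure)
  have "(\<lambda>x. x) \<in> borel_measurable (stieltjes I s)"
  proof (rule borel_measurableI_le)
    fix a :: real
    let ?J = "{x \<in> I. x \<le> a}"
    have J: "is_interval ?J" using I unfolding is_interval_1 by auto
    note D = interval_countable_Union_Icc[OF J]
    have "{p..q} \<in> sets (stieltjes I s)" if "p \<in> ?J" "q \<in> ?J" for p q
    proof (cases "p \<le> q")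
      case True
      with that show ?thesis unfolding eq by (intro sigma_sets.Basic) auto
    qed simp
    then have "?J \<in> sets (stieltjes I s)"
      using D(2) by (subst D(3), intro sets.countable_UN'' D(1)) blast+
    then show "{x \<in> space (stieltjes I s). x \<le> a} \<in> sets (stieltjes I s)"
      by (simp add: space_stieltjes[OF I])
  qed
  then have "sets (restrict_space borel I) \<subseteq> sets (stieltjes I s)"
    unfolding sets_restrict_space
    by (auto simp: measurable_def space_stieltjes[OF I] Int_commute)
  moreover have "sigma_sets I ?G \<subseteq> sets (restrict_space borel I)"
  proof -
    have "{a..b} \<in> sets (restrict_space borel I)" if "a \<in> I" "b \<in> I" for a b
      unfolding sets_restrict_space using Icc[OF that] by (intro image_eqI[of _ _ "{a..b}"]) auto
    then have "?G \<subseteq> sets (restrict_space borel I)" by auto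
    from sets.sigma_sets_subset[OF this] show ?thesis by (simp add: space_restrict_space)
  qed
  ultimately show ?thesis using eq by auto
qed

lemma emeasure_stieltjes:
  assumes I: "is_interval I" and s: "strict_mono_on I s" "continuous_on I s"
    and ab: "a \<in> I" "b \<in> I" "a \<le> b"
  shows "emeasure (stieltjes I s) {a..b} = ennreal (s b - s a)"
proof -
  let ?g = "the_inv_into I s"
  let ?L = "restrict_space lborel (s ` I)"
  let ?N = "distr ?L (restrict_space borel I) ?g"
  have inj: "inj_on s I" using s(1) by (rule strict_mono_on_imp_inj_on)
  have le: "s x \<le> s y \<longleftrightarrow> x \<le> y" if "x \<in> I" "y \<in> I" for x y
    using s(1) that by (meson not_le_imp_less strict_mono_onD strict_mono_on_leD leD)
  have gs: "?g (s x) = x" if "x \<in> I" for x using the_inv_into_f_f[OF inj that] .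
  have gI: "?g y \<in> I" if "y \<in> s ` I" for y using gs that by auto
  have "connected (s ` I)"
    using s(2) I by (intro connected_continuous_image) (auto simp: is_interval_connected_1)
  then have sI: "s ` I \<in> sets borel"
    using is_interval_connected_1 real_interval_borel_measurable by blast
  have "mono_on (s ` I) ?g"
    by (intro mono_onI) (auto simp: gs le)
  then have "?g \<in> borel_measurable (restrict_space borel (s ` I))"
    by (rule borel_measurable_mono_on_fnc)
  then have "?g \<in> borel_measurable ?L"
    by (subst measurable_cong_sets[OF sets_restrict_space_cong[OF sets_lborel] refl])
  then have g: "?g \<in> ?L \<rightarrow>\<^sub>M restrict_space borel I"
    by (intro measurable_restrict_space2) (auto simp: space_restrict_space gI)
  have N: "emeasure ?N {p..q} = ennreal (s q - s p)" if pq: "p \<in> I" "q \<in> I" "p \<le> q" for p q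
  proof -
    have sub: "{p..q} \<subseteq> I" using interval_Icc_subset[OF I pq(1,2)] .
    have ivt: "\<exists>x\<in>{p..q}. s x = y" if "y \<in> {s p..s q}" for y
      using IVT'[of s p y q] that pq(3) continuous_on_subset[OF s(2) sub] by auto
    have im: "s ` {p..q} = {s p..s q}"
    proof (intro equalityI subsetI)
      fix y assume "y \<in> s ` {p..q}"
      then obtain x where x: "p \<le> x" "x \<le> q" "y = s x" by auto
      then have "x \<in> I" using sub by auto
      with x le[OF pq(1), of x] le[OF _ pq(2), of x] show "y \<in> {s p..s q}" by simp
    qed (use ivt in blast)
    have "?g -` {p..q} \<inter> s ` I = {s p..s q}"
    proof (intro equalityI subsetI)
      fix y assume "y \<in> ?g -` {p..q} \<inter> s ` I"
      then obtain x where "x \<in> I" "y = s x" "?g y \<in> {p..q}" by blast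
      then have "y \<in> s ` {p..q}" using gs by simp
      then show "y \<in> {s p..s q}" unfolding im .
    next
      fix y assume "y \<in> {s p..s q}"
      then obtain x where x: "x \<in> {p..q}" "s x = y" using ivt by blast
      moreover from x have "x \<in> I" using sub by blast
      ultimately show "y \<in> ?g -` {p..q} \<inter> s ` I" using gs by auto
    qed
    then have pre: "?g -` {p..q} \<inter> space ?L = {s p..s q}"
      by (simp add: space_restrict_space)
    have "{p..q} \<in> sets (restrict_space borel I)"
      unfolding sets_restrict_space using sub by (intro image_eqI[of _ _ "{p..q}"]) auto
    then have "emeasure ?N {p..q} = emeasure ?L (?g -` {p..q} \<inter> space ?L)"
      by (rule emeasure_distr[OF g])
    also have "\<dots> = emeasure lborel {s p..s q}"
    proof -
      have "{s p..s q} \<subseteq> s ` I" using im sub by blast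
      with sI show ?thesis unfolding pre by (intro emeasure_restrict_space) auto
    qed
    also have "\<dots> = ennreal (s q - s p)"
      using le[OF pq(1,2)] pq(3) by simp
    finally show ?thesis .
  qed
  have "emeasure (stieltjes I s) ((\<lambda>(a, b). {a..b}) (a, b)) = (\<lambda>(a, b). ennreal (s b - s a)) (a, b)"
  proof (rule emeasure_extend_measure[OF stieltjes_def, where \<mu>' = "emeasure ?N"])
    have sets_eq: "sets (stieltjes I s) = sets ?N" using I by simp
    show "countably_additive (sets (stieltjes I s)) (emeasure ?N)"
      unfolding sets_eq by (rule emeasure_countably_additive)
    show "positive (sets (stieltjes I s)) (emeasure ?N)"
      unfolding sets_eq by (rule emeasure_positive)
    show "(\<lambda>(a, b). {a..b}) ` {(a, b). a \<in> I \<and> b \<in> I \<and> a \<le> b} \<subseteq> Pow I"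
      using interval_Icc_subset[OF I] by auto
    show "emeasure ?N (case i of (a, b) \<Rightarrow> {a..b}) = (case i of (a, b) \<Rightarrow> ennreal (s b - s a))"
      if "i \<in> {(a, b). a \<in> I \<and> b \<in> I \<and> a \<le> b}" for i
    proof (cases i)
      case (Pair p q)
      with that N[of p q] show ?thesis by simp
    qed
    show "(a, b) \<in> {(a, b). a \<in> I \<and> b \<in> I \<and> a \<le> b}"
      using ab by simp
  qed
  then show ?thesis by simp
qed


section \<open>The spaces \<open>(\<E>\<^sub>0, \<F>\<^sub>0)\<close> given by \<open>s\<close>, \<open>m\<close> and \<open>k\<close>\<close>

text \<open>
  Functions on \<open>I\<close> are total functions of which only the values on \<open>I\<close> matter. A class in
  \<open>L\<^sup>2\<close> with an absolutely continuous version is represented by that version, which is unique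
  on \<open>I\<close> because the measure has full support.
\<close>

definition L2 :: "'a measure \<Rightarrow> ('a \<Rightarrow> real) set" where
  "L2 \<mu> = {u \<in> borel_measurable \<mu>. integrable \<mu> (\<lambda>x. (u x)\<^sup>2)}"

definition has_ds_deriv :: "real set \<Rightarrow> (real \<Rightarrow> real) \<Rightarrow> (real \<Rightarrow> real) \<Rightarrow> (real \<Rightarrow> real) \<Rightarrow> bool" where
  "has_ds_deriv I s u g \<longleftrightarrow>
     (\<forall>x\<in>I. \<forall>y\<in>I. x < y \<longrightarrow>
        set_integrable (stieltjes I s) {x..y} g \<and>
        u y - u x = (LINT z:{x..y}|stieltjes I s. g z))"

definition ac_wrt :: "real set \<Rightarrow> (real \<Rightarrow> real) \<Rightarrow> (real \<Rightarrow> real) \<Rightarrow> bool" where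
  "ac_wrt I s u \<longleftrightarrow> (\<exists>g. has_ds_deriv I s u g)"

text \<open>\<open>du/ds\<close> is determined up to \<open>ds\<close>-null sets.\<close>

definition ds_deriv :: "real set \<Rightarrow> (real \<Rightarrow> real) \<Rightarrow> (real \<Rightarrow> real) \<Rightarrow> real \<Rightarrow> real" where
  "ds_deriv I s u = (SOME g. has_ds_deriv I s u g)"

definition dom_smk :: "real set \<Rightarrow> (real \<Rightarrow> real) \<Rightarrow> real measure \<Rightarrow> real measure \<Rightarrow> (real \<Rightarrow> real) set" where
  "dom_smk I s m k =
     {u \<in> L2 (add_measure m k). ac_wrt I s u \<and> ds_deriv I s u \<in> L2 (stieltjes I s)}"

definition form_smk ::
    "real set \<Rightarrow> (real \<Rightarrow> real) \<Rightarrow> real measure \<Rightarrow> (real \<Rightarrow> real) \<Rightarrow> (real \<Rightarrow> real) \<Rightarrow> real" where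
  "form_smk I s k u v =
     (\<integral>x. ds_deriv I s u x * ds_deriv I s v x \<partial>stieltjes I s) + (\<integral>x. u x * v x \<partial>k)"

definition left_end :: "real set \<Rightarrow> ereal" where
  "left_end I = (INF x\<in>I. ereal x)"

definition right_end :: "real set \<Rightarrow> ereal" where
  "right_end I = (SUP x\<in>I. ereal x)"

text \<open>The filters \<open>x \<down> a\<^sub>1\<close> and \<open>x \<up> a\<^sub>2\<close> on the real line, also for infinite end-points.\<close>

definition to_left_end :: "real set \<Rightarrow> real filter" where
  "to_left_end I = filtercomap ereal (at_right (left_end I))"

definition to_right_end :: "real set \<Rightarrow> real filter" where
  "to_right_end I = filtercomap ereal (at_left (right_end I))"

text \<open>As \<open>s\<close> is monotone, finiteness of its limit at an end-point is existence of a real limit.\<close>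

definition left_regular :: "real set \<Rightarrow> (real \<Rightarrow> real) \<Rightarrow> real measure \<Rightarrow> real measure \<Rightarrow> bool" where
  "left_regular I s m k \<longleftrightarrow>
     left_end I \<notin> ereal ` I \<and>
     (\<exists>l::real. (s \<longlongrightarrow> l) (to_left_end I)) \<and>
     (\<exists>c\<in>I. emeasure m {x\<in>I. x < c} + emeasure k {x\<in>I. x < c} < \<infinity>)"

definition right_regular :: "real set \<Rightarrow> (real \<Rightarrow> real) \<Rightarrow> real measure \<Rightarrow> real measure \<Rightarrow> bool" where
  "right_regular I s m k \<longleftrightarrow>
     right_end I \<notin> ereal ` I \<and>
     (\<exists>l::real. (s \<longlongrightarrow> l) (to_right_end I)) \<and>
     (\<exists>c\<in>I. emeasure m {x\<in>I. c < x} + emeasure k {x\<in>I. c < x} < \<infinity>)"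

definition dom0_smk :: "real set \<Rightarrow> (real \<Rightarrow> real) \<Rightarrow> real measure \<Rightarrow> real measure \<Rightarrow> (real \<Rightarrow> real) set" where
  "dom0_smk I s m k =
     {u \<in> dom_smk I s m k.
        (left_regular I s m k \<longrightarrow> (u \<longlongrightarrow> 0) (to_left_end I)) \<and>
        (right_regular I s m k \<longrightarrow> (u \<longlongrightarrow> 0) (to_right_end I))}"


section \<open>Regular local Dirichlet spaces\<close>

text \<open>
  A Dirichlet space on \<open>L\<^sup>2(m)\<close> is a form \<open>E\<close> together with its domain \<open>F\<close>. Outside \<open>F\<close> the values of
  \<open>E\<close> are irrelevant. \<open>F\<close> is a set of representatives: the classes in the domain are those of the
  members of \<open>F\<close>, but \<open>F\<close> need not contain every representative of each of them.
\<close>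

type_synonym form = "(real \<Rightarrow> real) \<Rightarrow> (real \<Rightarrow> real) \<Rightarrow> real"

definition form1 :: "real measure \<Rightarrow> form \<Rightarrow> form" where
  "form1 m E u v = E u v + (\<integral>x. u x * v x \<partial>m)"

definition dirichlet_space :: "real measure \<Rightarrow> form \<Rightarrow> (real \<Rightarrow> real) set \<Rightarrow> bool" where
  "dirichlet_space m E F \<longleftrightarrow>
     \<comment> \<open>dense linear subspace\<close>
     F \<subseteq> L2 m \<and> (\<lambda>x. 0) \<in> F \<and>
     (\<forall>u\<in>F. \<forall>v\<in>F. \<forall>a b. (\<lambda>x. a * u x + b * v x) \<in> F) \<and>
     (\<forall>f\<in>L2 m. \<forall>e>0. \<exists>u\<in>F. (\<integral>x. (f x - u x)\<^sup>2 \<partial>m) < e) \<and>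
     \<comment> \<open>nonnegative symmetric bilinear form, well defined on classes\<close>
     (\<forall>u\<in>F. \<forall>v\<in>F. \<forall>w\<in>F. \<forall>a b. E (\<lambda>x. a * u x + b * v x) w = a * E u w + b * E v w) \<and>
     (\<forall>u\<in>F. \<forall>v\<in>F. E u v = E v u) \<and>
     (\<forall>u\<in>F. 0 \<le> E u u) \<and>
     (\<forall>u\<in>F. \<forall>u'\<in>F. \<forall>v\<in>F. (AE x in m. u x = u' x) \<longrightarrow> E u v = E u' v) \<and>
     \<comment> \<open>closed\<close>
     (\<forall>w. (\<forall>n::nat. w n \<in> F) \<and>
          (\<forall>e>0. \<exists>N. \<forall>i\<ge>N. \<forall>j\<ge>N. form1 m E (\<lambda>x. w i x - w j x) (\<lambda>x. w i x - w j x) < e) \<longrightarrow>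
          (\<exists>u\<in>F. (\<lambda>n. form1 m E (\<lambda>x. w n x - u x) (\<lambda>x. w n x - u x)) \<longlonglongrightarrow> 0)) \<and>
     \<comment> \<open>the unit contraction operates\<close>
     (\<forall>u\<in>F. \<exists>v\<in>F. (AE x in m. v x = min (max (u x) 0) 1) \<and> E v v \<le> E u u)"

definition Cc :: "real set \<Rightarrow> (real \<Rightarrow> real) set" where
  "Cc I = {f. continuous_on I f \<and> (\<exists>K. compact K \<and> K \<subseteq> I \<and> (\<forall>x\<in>I - K. f x = 0))}"

definition regular_form :: "real set \<Rightarrow> real measure \<Rightarrow> form \<Rightarrow> (real \<Rightarrow> real) set \<Rightarrow> bool" where
  "regular_form I m E F \<longleftrightarrow>
     (\<forall>u\<in>F. \<forall>e>0. \<exists>v\<in>F \<inter> Cc I. form1 m E (\<lambda>x. u x - v x) (\<lambda>x. u x - v x) < e) \<and>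
     (\<forall>f\<in>Cc I. \<forall>e>0. \<exists>v\<in>F \<inter> Cc I. \<forall>x\<in>I. \<bar>f x - v x\<bar> < e)"

text \<open>The supports in question are those of the measures \<open>u \<cdot> m\<close> and \<open>v \<cdot> m\<close>.\<close>

definition local_form :: "real set \<Rightarrow> real measure \<Rightarrow> form \<Rightarrow> (real \<Rightarrow> real) set \<Rightarrow> bool" where
  "local_form I m E F \<longleftrightarrow>
     (\<forall>u\<in>F. \<forall>v\<in>F. \<forall>K L.
        compact K \<and> K \<subseteq> I \<and> (AE x in m. x \<notin> K \<longrightarrow> u x = 0) \<and>
        compact L \<and> L \<subseteq> I \<and> (AE x in m. x \<notin> L \<longrightarrow> v x = 0) \<and> K \<inter> L = {} \<longrightarrow> E u v = 0)"


section \<open>The associated Hunt process and irreducibility\<close>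

text \<open>
  The state space is the one-point compactification of \<open>I\<close>, in which \<^const>\<open>None\<close> is the cemetery
  (an isolated point when \<open>I\<close> is compact). Processes are realised on the canonical
  space of right-continuous paths with left limits for which the cemetery is absorbing. Paths are
  indexed by the real line, but only times \<open>t \<ge> 0\<close> play a role.
\<close>

definition state_top :: "real set \<Rightarrow> real option topology" where
  "state_top I = Alexandroff_compactification (top_of_set I)"

definition state_space :: "real set \<Rightarrow> real option measure" where
  "state_space I = sigma (topspace (state_top I)) {U. openin (state_top I) U}"

type_synonym path = "real \<Rightarrow> real option"

definition paths :: "real set \<Rightarrow> path set" where
  "paths I =
     {\<omega>. (\<forall>t\<ge>0. limitin (state_top I) \<omega> (\<omega> t) (at_right t)) \<and>
         (\<forall>t>0. \<exists>l. limitin (state_top I) \<omega> l (at_left t)) \<and>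
         (\<forall>s t. 0 \<le> s \<and> s \<le> t \<and> \<omega> s = None \<longrightarrow> \<omega> t = None)}"

definition path_space :: "real set \<Rightarrow> path measure" where
  "path_space I =
     sigma (paths I) {{\<omega> \<in> paths I. \<omega> s \<in> A} | s A. 0 \<le> s \<and> A \<in> sets (state_space I)}"

definition past :: "real set \<Rightarrow> ennreal \<Rightarrow> path measure" where
  "past I t =
     sigma (paths I)
       {{\<omega> \<in> paths I. \<omega> s \<in> A} | s A. 0 \<le> s \<and> ennreal s \<le> t \<and> A \<in> sets (state_space I)}"

text \<open>The right-continuous filtration \<open>(\<F>\<^sub>t\<^sub>+)\<close> with \<open>\<F>\<^sub>\<infinity>\<^sub>+ = \<F>\<^sub>\<infinity>\<close>.\<close>

definition past_right :: "real set \<Rightarrow> ennreal \<Rightarrow> path measure" where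
  "past_right I t =
     (if t = \<infinity> then path_space I else sigma (paths I) (\<Inter>u\<in>{t<..}. sets (past I u)))"

lemma filtration_past_right: "filtration (paths I) (past_right I)"
proof
  show "space (past_right I t) = paths I" for t
    by (simp add: past_right_def path_space_def space_measure_of_conv)
next
  fix t u :: ennreal assume le: "t \<le> u"
  have top: "sets (past I \<infinity>) = sets (path_space I)"
    by (simp add: past_def path_space_def)
  have path: "space (path_space I) = paths I" "sets (path_space I) \<subseteq> Pow (paths I)"
  proof -
    show *: "space (path_space I) = paths I" by (simp add: path_space_def space_measure_of_conv)
    show "sets (path_space I) \<subseteq> Pow (paths I)"
      using sets.space_closed[of "path_space I"] unfolding * .
  qed
  let ?X = "\<lambda>w. \<Inter>v\<in>{w<..}. sets (past I v)"
  have X: "?X w \<subseteq> sets (path_space I)" if "w \<noteq> \<infinity>" for w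
  proof -
    have "\<infinity> \<in> {w<..}" using that by (simp add: less_top)
    then have "?X w \<subseteq> sets (past I \<infinity>)" by (rule INT_lower)
    then show ?thesis unfolding top .
  qed
  have eq: "sets (past_right I w) = sigma_sets (paths I) (?X w)" if "w \<noteq> \<infinity>" for w
  proof -
    have "?X w \<subseteq> Pow (paths I)" using X[OF that] path(2) by (rule subset_trans)
    from sets_measure_of[OF this] that show ?thesis by (simp only: past_right_def if_False)
  qed
  show "sets (past_right I t) \<subseteq> sets (past_right I u)"
  proof (cases "t = \<infinity>")
    case True
    with le show ?thesis by (simp add: top_unique)
  next
    case t: False
    show ?thesis
    proof (cases "u = \<infinity>")
      case True
      have "sigma_sets (paths I) (?X t) \<subseteq> sets (path_space I)"
        using sets.sigma_sets_subset[OF X[OF t]] path(1) by simp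
      then show ?thesis unfolding eq[OF t] using True by (simp add: past_right_def)
    next
      case False
      have "?X t \<subseteq> ?X u" using le by (intro INT_anti_mono) auto
      then show ?thesis unfolding eq[OF t] eq[OF False] by (rule sigma_sets_mono')
    qed
  qed
qed

text \<open>
  \<open>P x\<close> is the law of the process started at \<open>x\<close>. The two last conditions are the strong Markov
  property and quasi-left-continuity.
\<close>

definition hunt_process :: "real set \<Rightarrow> (real option \<Rightarrow> path measure) \<Rightarrow> bool" where
  "hunt_process I P \<longleftrightarrow>
     (\<forall>x\<in>topspace (state_top I).
        prob_space (P x) \<and> sets (P x) = sets (path_space I) \<and> (AE \<omega> in P x. \<omega> 0 = x)) \<and>
     (\<forall>t\<ge>0. \<forall>A\<in>sets (state_space I).
        (\<lambda>x. emeasure (P x) {\<omega> \<in> paths I. \<omega> t \<in> A}) \<in> borel_measurable (state_space I)) \<and>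
     (\<forall>x\<in>topspace (state_top I). \<forall>\<tau>. stopping_time (past_right I) \<tau> \<longrightarrow>
        (\<forall>\<Lambda>\<in>sets (filtration.pre_sigma (paths I) (past_right I) \<tau>).
          \<forall>s\<ge>0. \<forall>A\<in>sets (state_space I).
            emeasure (P x) {\<omega> \<in> \<Lambda>. \<tau> \<omega> < \<infinity> \<and> \<omega> (enn2real (\<tau> \<omega>) + s) \<in> A} =
            (\<integral>\<^sup>+\<omega>\<in>{\<omega> \<in> \<Lambda>. \<tau> \<omega> < \<infinity>}.
               emeasure (P (\<omega> (enn2real (\<tau> \<omega>)))) {\<omega>' \<in> paths I. \<omega>' s \<in> A} \<partial>P x))) \<and>
     (\<forall>x\<in>topspace (state_top I). \<forall>\<tau>.
        (\<forall>n::nat. stopping_time (past_right I) (\<tau> n)) \<and> (\<forall>\<omega>\<in>paths I. incseq (\<lambda>n. \<tau> n \<omega>)) \<longrightarrow>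
        (AE \<omega> in P x. (SUP n. \<tau> n \<omega>) < \<infinity> \<longrightarrow>
           limitin (state_top I) (\<lambda>n. \<omega> (enn2real (\<tau> n \<omega>)))
             (\<omega> (enn2real (SUP n. \<tau> n \<omega>))) sequentially))"

text \<open>The transition function, with functions on \<open>I\<close> extended by \<open>0\<close> to the cemetery.\<close>

definition transition :: "(real option \<Rightarrow> path measure) \<Rightarrow> real \<Rightarrow> (real \<Rightarrow> real) \<Rightarrow> real \<Rightarrow> real" where
  "transition P t u x = (\<integral>\<omega>. (case \<omega> t of None \<Rightarrow> 0 | Some y \<Rightarrow> u y) \<partial>P (Some x))"

definition nn_transition ::
    "(real option \<Rightarrow> path measure) \<Rightarrow> real \<Rightarrow> (real \<Rightarrow> ennreal) \<Rightarrow> real \<Rightarrow> ennreal" where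
  "nn_transition P t f x = (\<integral>\<^sup>+\<omega>. (case \<omega> t of None \<Rightarrow> 0 | Some y \<Rightarrow> f y) \<partial>P (Some x))"

definition symmetric_process :: "real measure \<Rightarrow> (real option \<Rightarrow> path measure) \<Rightarrow> bool" where
  "symmetric_process m P \<longleftrightarrow>
     (\<forall>t\<ge>0. \<forall>f\<in>borel_measurable m. \<forall>g\<in>borel_measurable m.
        (\<integral>\<^sup>+x. nn_transition P t f x * g x \<partial>m) = (\<integral>\<^sup>+x. f x * nn_transition P t g x \<partial>m))"

text \<open>
  \<open>(E, F)\<close> is the Dirichlet space of the semigroup \<open>(p\<^sub>t)\<close> of the process: its domain consists of the
  \<open>u \<in> L\<^sup>2(m)\<close> for which \<open>t\<^sup>-\<^sup>1 (u - p\<^sub>t u, u)\<close> has a finite limit as \<open>t \<down> 0\<close> (this quantity is monotone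
  in \<open>t\<close>), and \<open>E(u, v) = lim t\<^sup>-\<^sup>1 (u - p\<^sub>t u, v)\<close>.
\<close>

definition associated_process ::
    "real measure \<Rightarrow> form \<Rightarrow> (real \<Rightarrow> real) set \<Rightarrow> (real option \<Rightarrow> path measure) \<Rightarrow> bool" where
  "associated_process m E F P \<longleftrightarrow>
     (\<forall>u\<in>L2 m. (\<exists>v\<in>F. AE x in m. u x = v x) \<longleftrightarrow>
        (\<exists>l. ((\<lambda>t. (\<integral>x. (u x - transition P t u x) * u x \<partial>m) / t) \<longlongrightarrow> l) (at_right 0))) \<and>
     (\<forall>u\<in>F. \<forall>v\<in>F.
        ((\<lambda>t. (\<integral>x. (u x - transition P t u x) * v x \<partial>m) / t) \<longlongrightarrow> E u v) (at_right 0))"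

text \<open>Continuity of the paths on \<open>[0, \<zeta>)\<close>; right-continuity is part of \<^const>\<open>paths\<close>.\<close>

definition diffusion :: "real set \<Rightarrow> (real option \<Rightarrow> path measure) \<Rightarrow> bool" where
  "diffusion I P \<longleftrightarrow>
     (\<forall>x\<in>I. AE \<omega> in P (Some x). \<forall>t>0. \<omega> t \<noteq> None \<longrightarrow> limitin (state_top I) \<omega> (\<omega> t) (at_left t))"

text \<open>
  \<open>P\<^sup>x(T\<^sub>y < \<infinity>) > 0\<close> with \<open>T\<^sub>y = inf {t > 0. X\<^sub>t = y}\<close>, stated as: it is not the case that \<open>y\<close> is almost
  surely never hit.
\<close>

definition hits_all_points :: "real set \<Rightarrow> (real option \<Rightarrow> path measure) \<Rightarrow> bool" where
  "hits_all_points I P \<longleftrightarrow>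
     (\<forall>x\<in>I. \<forall>y\<in>I. \<not> (AE \<omega> in P (Some x). \<not> (\<exists>t>0. \<omega> t = Some y)))"

definition irreducible_form :: "real set \<Rightarrow> real measure \<Rightarrow> form \<Rightarrow> (real \<Rightarrow> real) set \<Rightarrow> bool" where
  "irreducible_form I m E F \<longleftrightarrow>
     (\<exists>P. hunt_process I P \<and> symmetric_process m P \<and> associated_process m E F P \<and>
          diffusion I P \<and> hits_all_points I P)"

definition local_irreducible_regular_dirichlet_space ::
    "real set \<Rightarrow> real measure \<Rightarrow> form \<Rightarrow> (real \<Rightarrow> real) set \<Rightarrow> bool" where
  "local_irreducible_regular_dirichlet_space I m E F \<longleftrightarrow>
     dirichlet_space m E F \<and> regular_form I m E F \<and> local_form I m E F \<and> irreducible_form I m E F"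

text \<open>\<open>(E, F) = (\<E>\<^sub>0, \<F>\<^sub>0)\<close>, where \<open>\<E>\<^sub>0\<close> is the restriction of the form to \<open>\<F>\<^sub>0\<close>.\<close>

definition represented_by ::
    "form \<Rightarrow> (real \<Rightarrow> real) set \<Rightarrow> real set \<Rightarrow> (real \<Rightarrow> real) \<Rightarrow> real measure \<Rightarrow> real measure \<Rightarrow> bool" where
  "represented_by E F I s m k \<longleftrightarrow>
     F = dom0_smk I s m k \<and> (\<forall>u\<in>F. \<forall>v\<in>F. E u v = form_smk I s k u v)"

definition regular_subspace ::
    "form \<Rightarrow> (real \<Rightarrow> real) set \<Rightarrow> form \<Rightarrow> (real \<Rightarrow> real) set \<Rightarrow> bool" where
  "regular_subspace E' F' E F \<longleftrightarrow> F' \<subseteq> F \<and> (\<forall>u\<in>F'. \<forall>v\<in>F'. E u v = E' u v)"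

end

theory Submission
  imports Defs
begin

text \<open>
  Suppose that \<open>ds\<^sub>2 = f \<cdot> ds\<^sub>1\<close>. The chain rule \<open>du/ds\<^sub>1 = f \<cdot> du/ds\<^sub>2\<close> turns both forms into integrals
  against \<open>ds\<^sub>1\<close>: for \<open>u\<close> and \<open>v\<close> with derivatives \<open>g\<close> and \<open>h\<close> in the scale \<open>s\<^sub>2\<close>,
  the energy is \<open>\<integral> f g h ds\<^sub>1 + \<integral> u v dk\<^sub>2\<close> for \<open>s\<^sub>2\<close> and \<open>\<integral> f\<^sup>2 g h ds\<^sub>1 + \<integral> u v dk\<^sub>1\<close> for \<open>s\<^sub>1\<close>
  (\<open>form_smk_change_scale\<close>). If \<open>f\<close> has only the values \<open>0\<close> and \<open>1\<close> and \<open>k\<^sub>1 = k\<^sub>2\<close>, the forms therefore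
  agree and the domain for \<open>s\<^sub>2\<close> is contained in that for \<open>s\<^sub>1\<close> (\<open>dom0_subset\<close>). The boundary conditions
  cause no trouble because \<open>ds\<^sub>2 \<le> ds\<^sub>1\<close>: an end-point that is regular for \<open>s\<^sub>1\<close> is regular for \<open>s\<^sub>2\<close>.

  For the converse the forms are tested on explicit functions, the plateaus. They are \<open>0\<close> outside a
  compact interval, \<open>1\<close> on a smaller one and affine in \<open>s\<^sub>2\<close> in between, and they belong to the domain for
  \<open>s\<^sub>2\<close> (\<open>plateau_mem_dom0\<close>). As they also belong to the domain for \<open>s\<^sub>1\<close>, the function \<open>s\<^sub>2\<close> is locally
  an integral with respect to \<open>ds\<^sub>1\<close>, and \<open>ds\<^sub>2\<close> has a density \<open>f\<close>
  (\<open>absolutely_continuous_of_dom0_subset\<close>). Equality of the forms is then used twice.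
  Let \<open>u\<close> be a plateau and \<open>v\<close> a wider one that equals \<open>1\<close> where \<open>u \<noteq> 0\<close>. Their derivatives live on
  disjoint sets, so only the killing terms remain and \<open>\<integral> u dk\<^sub>1 = \<integral> u dk\<^sub>2\<close>. Letting \<open>u\<close> decrease to the
  indicator of a compact interval gives \<open>k\<^sub>1 = k\<^sub>2\<close> (\<open>killing_measures_eq\<close>). Then let \<open>u\<close> and \<open>v\<close> be two
  plateaus that rise on the same interval \<open>{p..q}\<close> and fall on disjoint ones. Now
  \<open>\<integral> f\<^sup>2 ds\<^sub>1 = \<integral> f ds\<^sub>1\<close> over \<open>{p..q}\<close>, whence \<open>f\<^sup>2 = f\<close> almost everywhere (\<open>density_0_or_1\<close>).

  All these comparisons rest on the fact that locally finite measures on \<open>I\<close> are determined by their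
  values on compact intervals (\<open>measure_eqI_Icc\<close>).
\<close>


section \<open>Measures on an interval determined by compact intervals\<close>

lemma Icc_in_sets:
  fixes I :: "real set"
  assumes "is_interval I" "a \<in> I" "b \<in> I"
  shows "{a..b} \<in> sets (restrict_space borel I)"
  unfolding sets_restrict_space using interval_Icc_subset[OF assms]
  by (intro image_eqI[of _ _ "{a..b}"]) auto

lemma space_of_borel_sets:
  assumes "sets M = sets (restrict_space borel I)"
  shows "space M = I"
  using sets_eq_imp_space_eq[OF assms] by (simp add: space_restrict_space)

lemma countable_Icc_cover:
  fixes I :: "real set"
  assumes "is_interval I"
  obtains A where "countable A" "\<Union>A = I" "\<And>X. X \<in> A \<Longrightarrow> \<exists>p\<in>I. \<exists>q\<in>I. p \<le> q \<and> X = {p..q}"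
proof -
  define D where "D = I \<inter> (\<rat> \<union> {Inf I, Sup I})"
  note D = interval_countable_Union_Icc[OF assms, folded D_def]
  show ?thesis
  proof
    let ?A = "(\<lambda>(p, q). {p..q}) ` {(p, q) \<in> D \<times> D. p \<le> q}"
    show "countable ?A" 
      by (rule countable_image, rule countable_subset[of _ "D \<times> D"]) (use D(1) in auto)
    have "\<Union>?A = (\<Union>p\<in>D. \<Union>q\<in>D. {p..q})"
    proof (intro equalityI subsetI)
      fix x assume "x \<in> (\<Union>p\<in>D. \<Union>q\<in>D. {p..q})"
      then obtain p q where "p \<in> D" "q \<in> D" "p \<le> x" "x \<le> q" by auto
      then show "x \<in> \<Union>?A" by (intro UnionI[of "{p..q}"] image_eqI[of _ _ "(p, q)"]) auto
    qed auto
    then show "\<Union>?A = I" unfolding D(3)[symmetric] .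
    show "\<exists>p\<in>I. \<exists>q\<in>I. p \<le> q \<and> X = {p..q}" if "X \<in> ?A" for X using that D(2) by auto
  qed
qed

lemma measure_eqI_Icc:
  fixes I :: "real set"
  assumes I: "is_interval I"
    and M: "sets M = sets (restrict_space borel I)" and N: "sets N = sets (restrict_space borel I)"
    and eq: "\<And>p q. p \<in> I \<Longrightarrow> q \<in> I \<Longrightarrow> p \<le> q \<Longrightarrow> emeasure M {p..q} = emeasure N {p..q}"
    and fin: "\<And>p q. p \<in> I \<Longrightarrow> q \<in> I \<Longrightarrow> p \<le> q \<Longrightarrow> emeasure M {p..q} < \<infinity>"
  shows "M = N"
proof -
  let ?G = "(\<lambda>(a, b). {a..b}) ` {(a, b). a \<in> I \<and> b \<in> I \<and> a \<le> b}"
  have sub: "?G \<subseteq> Pow I" using interval_Icc_subset[OF I] by auto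
  have "sets (stieltjes I id) = sigma_sets I ?G"
    unfolding stieltjes_def using sub by (rule sets_extend_measure)
  then have gen: "sets (restrict_space borel I) = sigma_sets I ?G"
    using I by simp
  have empt: "sigma_sets I (insert {} ?G) = sigma_sets I ?G"
    by (rule sigma_sets_eqI) (auto intro: sigma_sets.Basic sigma_sets.Empty)
  obtain A where A: "countable A" "\<Union>A = I"
    "\<And>X. X \<in> A \<Longrightarrow> \<exists>p\<in>I. \<exists>q\<in>I. p \<le> q \<and> X = {p..q}"
    by (rule countable_Icc_cover[OF I]) blast
  show ?thesis
  proof (rule measure_eqI_generator_eq_countable[where E = "insert {} ?G" and A = A])
    have "X \<inter> Y \<in> insert {} ?G" if XG: "X \<in> ?G" and YG: "Y \<in> ?G" for X Y
    proof -
      obtain a b c d where *: "a \<in> I" "b \<in> I" "X = {a..b}" "c \<in> I" "d \<in> I" "Y = {c..d}"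
        using XG YG by auto
      have XY: "X \<inter> Y = {max a c..min b d}" using * by simp
      show ?thesis
      proof (cases "max a c \<le> min b d")
        case True
        moreover have "max a c \<in> I" "min b d \<in> I" using * by (simp_all add: max_def min_def)
        ultimately have "(max a c, min b d) \<in> {(a, b). a \<in> I \<and> b \<in> I \<and> a \<le> b}" by simp
        then have "{max a c..min b d} \<in> ?G"
          by (rule image_eqI[of _ _ "(max a c, min b d)", rotated]) (simp only: prod.case)
        then show ?thesis unfolding XY by (rule insertI2)
      next
        case False
        then show ?thesis unfolding XY by simp
      qed
    qed
    then have "X \<inter> Y \<in> insert {} ?G" if "X \<in> insert {} ?G" "Y \<in> insert {} ?G" for X Y
      using that by (elim insertE) simp_all
    then show "Int_stable (insert {} ?G)" by (rule Int_stableI)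
    show "insert {} ?G \<subseteq> Pow I" using sub by auto
    show "emeasure M X = emeasure N X" if "X \<in> insert {} ?G" for X
      using that by (auto intro: eq)
    show "sets M = sigma_sets I (insert {} ?G)" "sets N = sigma_sets I (insert {} ?G)"
      unfolding empt M N gen by (rule refl)+
    show "A \<subseteq> insert {} ?G"
    proof
      fix X assume "X \<in> A"
      then obtain p q where "p \<in> I" "q \<in> I" "p \<le> q" "X = {p..q}" using A(3) by blast
      then show "X \<in> insert {} ?G" by (intro insertI2 image_eqI[of _ _ "(p, q)"]) auto
    qed
    show "\<Union>A = I" "countable A" by fact+
    show "emeasure M a \<noteq> \<infinity>" if "a \<in> A" for a
    proof -
      obtain p q where "p \<in> I" "q \<in> I" "p \<le> q" "a = {p..q}" using A(3) \<open>a \<in> A\<close> by blast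
      then show ?thesis using fin[of p q] by simp
    qed
  qed
qed

text \<open>
  A signed measure \<open>h \<cdot> M\<close> that agrees with a positive measure \<open>N\<close> on compact intervals is equal to
  it. To avoid signed measures, the negative part is moved to the other side of the equation.
\<close>

lemma add_density_neg_eq_density_pos:
  fixes h :: "real \<Rightarrow> real"
  assumes I: "is_interval I"
    and M: "sets M = sets (restrict_space borel I)" and N: "sets N = sets (restrict_space borel I)"
    and h: "h \<in> borel_measurable M"
    and int: "\<And>p q. p \<in> I \<Longrightarrow> q \<in> I \<Longrightarrow> p \<le> q \<Longrightarrow> set_integrable M {p..q} h"
    and eq: "\<And>p q. p \<in> I \<Longrightarrow> q \<in> I \<Longrightarrow> p \<le> q \<Longrightarrow>
      emeasure N {p..q} = ennreal (LINT z:{p..q}|M. h z) \<and> 0 \<le> (LINT z:{p..q}|M. h z)"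
  shows "add_measure N (density M (\<lambda>x. ennreal (- h x))) = density M (\<lambda>x. ennreal (h x))"
proof (rule measure_eqI_Icc[OF I])
  fix p q assume pq: "p \<in> I" "q \<in> I" "p \<le> q"
  note [measurable] = h
  have S[measurable]: "{p..q} \<in> sets M" using Icc_in_sets[OF I pq(1,2)] M by simp
  let ?h = "\<lambda>x. indicator {p..q} x *\<^sub>R h x"
  have i: "integrable M ?h" using int[OF pq] by (simp add: set_integrable_def)
  have pos: "emeasure (density M (\<lambda>x. ennreal (h x))) {p..q} = (\<integral>\<^sup>+x. ennreal (?h x) \<partial>M)"
    by (subst emeasure_density) (auto intro!: nn_integral_cong split: split_indicator)
  have neg: "emeasure (density M (\<lambda>x. ennreal (- h x))) {p..q} = (\<integral>\<^sup>+x. ennreal (- ?h x) \<partial>M)"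
    by (subst emeasure_density) (auto intro!: nn_integral_cong split: split_indicator)
  obtain a where a: "(\<integral>\<^sup>+x. ennreal (?h x) \<partial>M) = ennreal a" "0 \<le> a"
    using integrableD(2)[OF i] by (cases "\<integral>\<^sup>+x. ennreal (?h x) \<partial>M" rule: ennreal_cases) auto
  obtain b where b: "(\<integral>\<^sup>+x. ennreal (- ?h x) \<partial>M) = ennreal b" "0 \<le> b"
    using integrableD(3)[OF i] by (cases "\<integral>\<^sup>+x. ennreal (- ?h x) \<partial>M" rule: ennreal_cases) auto
  note ab = a b
  have L: "(LINT z:{p..q}|M. h z) = a - b"
    unfolding set_lebesgue_integral_def real_lebesgue_integral_def[OF i] ab(1,3) using ab(2,4) by simp
  have "emeasure (add_measure N (density M (\<lambda>x. ennreal (- h x)))) {p..q} = ennreal (a - b) + ennreal b"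
    using S M N eq[OF pq] ab by (simp add: emeasure_add_measure neg L)
  also have "\<dots> = ennreal a" using eq[OF pq] ab(4) unfolding L by (simp flip: ennreal_plus)
  finally show e: "emeasure (add_measure N (density M (\<lambda>x. ennreal (- h x)))) {p..q} =
      emeasure (density M (\<lambda>x. ennreal (h x))) {p..q}"
    unfolding pos ab .
  show "emeasure (add_measure N (density M (\<lambda>x. ennreal (- h x)))) {p..q} < \<infinity>"
    unfolding e pos ab by simp
qed (use M N in auto)


section \<open>The measure and the derivative of a scale function\<close>

locale interval_scale =
  fixes I :: "real set" and s :: "real \<Rightarrow> real"
  assumes I: "is_interval I" and smono: "strict_mono_on I s" and scont: "continuous_on I s"
begin

abbreviation S :: "real measure" where "S \<equiv> stieltjes I s"

lemma sets_S: "sets S = sets (restrict_space borel I)" and space_S: "space S = I"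
  using I by (simp_all add: space_stieltjes)

lemma s_less: "x \<in> I \<Longrightarrow> y \<in> I \<Longrightarrow> x < y \<Longrightarrow> s x < s y"
  using smono by (rule strict_mono_onD)

lemma s_le: "x \<in> I \<Longrightarrow> y \<in> I \<Longrightarrow> x \<le> y \<Longrightarrow> s x \<le> s y"
  using s_less[of x y] by (cases "x = y") auto

lemma emeasure_S: "a \<in> I \<Longrightarrow> b \<in> I \<Longrightarrow> a \<le> b \<Longrightarrow> emeasure S {a..b} = ennreal (s b - s a)"
  using emeasure_stieltjes[OF I smono scont] .

lemma Icc_sets_S: "a \<in> I \<Longrightarrow> b \<in> I \<Longrightarrow> {a..b} \<in> sets S"
  using Icc_in_sets[OF I] sets_S by simp

lemma AE_S_neq: "AE x in S. x \<noteq> c"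
proof (cases "c \<in> I")
  case True
  then have "{c} \<in> null_sets S"
    using emeasure_S[of c c] Icc_sets_S[of c c] by (simp add: null_sets_def)
  then show ?thesis by (rule AE_I') auto
next
  case False
  then show ?thesis by (intro AE_I2) (auto simp: space_S)
qed

sublocale sigma_finite_measure S
proof
  obtain A where A: "countable A" "\<Union>A = I"
    "\<And>X. X \<in> A \<Longrightarrow> \<exists>p\<in>I. \<exists>q\<in>I. p \<le> q \<and> X = {p..q}"
    by (rule countable_Icc_cover[OF I]) blast
  show "\<exists>A. countable A \<and> A \<subseteq> sets S \<and> \<Union>A = space S \<and> (\<forall>a\<in>A. emeasure S a \<noteq> \<infinity>)"
  proof (intro exI[of _ A] conjI ballI)
    show "A \<subseteq> sets S" using A(3) Icc_sets_S by blast
    show "\<Union>A = space S" using A(2) by (simp add: space_S)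
    fix a assume "a \<in> A"
    then obtain p q where "p \<in> I" "q \<in> I" "p \<le> q" "a = {p..q}" using A(3) by blast
    then show "emeasure S a \<noteq> \<infinity>" using emeasure_S[of p q] by simp
  qed (rule A(1))
qed

lemma has_ds_deriv_set_integrable:
  assumes "has_ds_deriv I s u g" "x \<in> I" "y \<in> I" "x \<le> y"
  shows "set_integrable S {x..y} g" "u y - u x = (LINT z:{x..y}|S. g z)"
proof -
  have "set_integrable S {x..y} g \<and> u y - u x = (LINT z:{x..y}|S. g z)"
  proof (cases "x = y")
    case True
    \<comment> \<open>Points are null sets; \<open>g\<close> may be replaced there by the constant \<open>g x\<close>.\<close>
    have z: "(\<lambda>z. indicator {x..y} z *\<^sub>R g z) = (\<lambda>z. indicator {x..y} z *\<^sub>R g x)"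
      using True by (auto split: split_indicator)
    have "emeasure S {x..y} = 0" using True assms emeasure_S[of x x] by simp
    moreover have "{x..y} \<in> sets S" using assms Icc_sets_S by simp
    ultimately show ?thesis
      unfolding set_integrable_def set_lebesgue_integral_def z using True by (simp add: measure_def)
  qed (use assms in \<open>auto simp: has_ds_deriv_def\<close>)
  then show "set_integrable S {x..y} g" "u y - u x = (LINT z:{x..y}|S. g z)" by auto
qed

lemma has_ds_deriv_measurable:
  assumes "has_ds_deriv I s u g"
  shows "g \<in> borel_measurable S"
proof -
  obtain A where A: "countable A" "\<Union>A = I"
    "\<And>X. X \<in> A \<Longrightarrow> \<exists>p\<in>I. \<exists>q\<in>I. p \<le> q \<and> X = {p..q}"
    by (rule countable_Icc_cover[OF I]) blast
  show ?thesis
  proof (rule measurable_piecewise_restrict[OF A(1)])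
    show "space S \<subseteq> \<Union>A" using A(2) by (simp add: space_S)
    fix a assume "a \<in> A"
    then obtain p q where pq: "p \<in> I" "q \<in> I" "p \<le> q" "a = {p..q}" using A(3) by blast
    then show a: "a \<inter> space S \<in> sets S"
      using Icc_sets_S interval_Icc_subset[OF I] by (simp add: space_S Int_absorb2)
    have "(\<lambda>x. indicator a x *\<^sub>R g x) \<in> borel_measurable S"
      using has_ds_deriv_set_integrable(1)[OF assms pq(1-3)] pq(4) by (auto simp: set_integrable_def)
    then show "g \<in> borel_measurable (restrict_space S a)"
      unfolding borel_measurable_restrict_space_iff[OF a] .
  qed
qed

text \<open>
  The difference of two derivatives has integral \<open>0\<close> over every compact interval, so that its positive
  and its negative part are densities of the same measure.
\<close>

lemma has_ds_deriv_AE_unique: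
  assumes g: "has_ds_deriv I s u g" and g': "has_ds_deriv I s u g'"
  shows "AE x in S. g x = g' x"
proof -
  note [measurable] = has_ds_deriv_measurable[OF g] has_ds_deriv_measurable[OF g']
  let ?h = "\<lambda>x. g x - g' x"
  let ?Z = "density S (\<lambda>x. 0)"
  have "add_measure ?Z (density S (\<lambda>x. ennreal (- ?h x))) = density S (\<lambda>x. ennreal (?h x))"
  proof (rule add_density_neg_eq_density_pos[OF I])
    fix p q assume pq: "p \<in> I" "q \<in> I" "p \<le> q"
    note 1 = has_ds_deriv_set_integrable[OF g pq] and 2 = has_ds_deriv_set_integrable[OF g' pq]
    show "set_integrable S {p..q} ?h" using 1 2 by (simp add: set_integral_diff)
    have "(LINT z:{p..q}|S. ?h z) = 0" using 1 2 by (simp add: set_integral_diff)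
    then show "emeasure ?Z {p..q} = ennreal (LINT z:{p..q}|S. ?h z) \<and> 0 \<le> (LINT z:{p..q}|S. ?h z)"
      using Icc_sets_S[OF pq(1,2)] by (simp add: emeasure_density)
  qed (auto simp: sets_S)
  moreover have "add_measure ?Z (density S (\<lambda>x. ennreal (- ?h x))) = density S (\<lambda>x. ennreal (- ?h x))"
    by (rule measure_eqI) (auto simp: emeasure_add_measure emeasure_density)
  ultimately have "density S (\<lambda>x. ennreal (- ?h x)) = density S (\<lambda>x. ennreal (?h x))" by simp
  then have "AE x in S. ennreal (- ?h x) = ennreal (?h x)"
    by (subst (asm) density_unique_iff) auto
  then show ?thesis
  proof eventually_elim
    case (elim x)
    then show ?case by (cases "0 \<le> ?h x") (auto simp: ennreal_neg ennreal_eq_0_iff)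
  qed
qed

lemma has_ds_deriv_ds_deriv: "has_ds_deriv I s u g \<Longrightarrow> has_ds_deriv I s u (ds_deriv I s u)"
  unfolding ds_deriv_def by (rule someI[where P = "has_ds_deriv I s u"])

lemma ds_deriv_AE_eq: "has_ds_deriv I s u g \<Longrightarrow> AE x in S. ds_deriv I s u x = g x"
  using has_ds_deriv_AE_unique[OF has_ds_deriv_ds_deriv] .

lemma ds_deriv_in_L2_iff:
  assumes "has_ds_deriv I s u g"
  shows "ds_deriv I s u \<in> L2 S \<longleftrightarrow> g \<in> L2 S"
proof -
  note [measurable] = has_ds_deriv_measurable[OF assms]
    has_ds_deriv_measurable[OF has_ds_deriv_ds_deriv[OF assms]]
  have "integrable S (\<lambda>x. (ds_deriv I s u x)\<^sup>2) \<longleftrightarrow> integrable S (\<lambda>x. (g x)\<^sup>2)"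
    using ds_deriv_AE_eq[OF assms] by (intro integrable_cong_AE) auto
  then show ?thesis by (simp add: L2_def)
qed

lemma form_smk_eq:
  assumes g: "has_ds_deriv I s u g" and g': "has_ds_deriv I s v g'"
  shows "form_smk I s k u v = (\<integral>x. g x * g' x \<partial>S) + (\<integral>x. u x * v x \<partial>k)"
proof -
  note [measurable] = has_ds_deriv_measurable[OF g] has_ds_deriv_measurable[OF g']
    has_ds_deriv_measurable[OF has_ds_deriv_ds_deriv[OF g]]
    has_ds_deriv_measurable[OF has_ds_deriv_ds_deriv[OF g']]
  have "(\<integral>x. ds_deriv I s u x * ds_deriv I s v x \<partial>S) = (\<integral>x. g x * g' x \<partial>S)"
    using ds_deriv_AE_eq[OF g] ds_deriv_AE_eq[OF g'] by (intro integral_cong_AE) auto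
  then show ?thesis by (simp add: form_smk_def)
qed

end


section \<open>Behaviour at the end-points\<close>

text \<open>
  Near an end-point outside \<open>I\<close> the filter sees only points of \<open>I\<close>, so that limits at the end-point are
  statements about \<open>I\<close> alone, also when the end-point is infinite.
\<close>

lemma eventually_to_left_end_iff:
  fixes I :: "real set"
  assumes I: "is_interval I" and ne: "I \<noteq> {}" and left: "left_end I \<notin> ereal ` I"
  shows "eventually P (to_left_end I) \<longleftrightarrow> (\<exists>c\<in>I. \<forall>x\<in>I. x < c \<longrightarrow> P x)"
proof -
  obtain z where z: "z \<in> I" using ne by auto
  have less: "left_end I < ereal x" if "x \<in> I" for x
    using that left INF_lower[of x I ereal] unfolding left_end_def by (metis image_eqI order_le_less)
  have ex: "\<exists>y\<in>I. ereal y < b" if "left_end I < b" for b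
    using that unfolding left_end_def by (simp add: INF_less_iff)
  have mem: "x \<in> I" if x: "left_end I < ereal x" "x < c" "c \<in> I" for x c
  proof -
    obtain y where "y \<in> I" "y < x" using ex[OF x(1)] by auto
    then show ?thesis using mem_is_interval_1_I[OF I, of y c x] x by auto
  qed
  show ?thesis
  proof
    assume "eventually P (to_left_end I)"
    then obtain Q where Q: "eventually Q (at_right (left_end I))" "\<And>x. Q (ereal x) \<Longrightarrow> P x"
      unfolding to_left_end_def eventually_filtercomap by blast
    then obtain b where b: "left_end I < b" "\<And>y. left_end I < y \<Longrightarrow> y < b \<Longrightarrow> Q y"
      using eventually_at_right[OF less[OF z], of Q] by auto
    obtain c where c: "c \<in> I" "ereal c < b" using ex[OF b(1)] by auto
    have "P x" if "x \<in> I" "x < c" for x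
      using Q(2) b(2)[OF less[OF that(1)]] c(2) that(2)
      by (meson less_ereal.simps(1) less_trans)
    then show "\<exists>c\<in>I. \<forall>x\<in>I. x < c \<longrightarrow> P x" using c(1) by blast
  next
    assume "\<exists>c\<in>I. \<forall>x\<in>I. x < c \<longrightarrow> P x"
    then obtain c where c: "c \<in> I" "\<And>x. x \<in> I \<Longrightarrow> x < c \<Longrightarrow> P x" by blast
    have "eventually (\<lambda>y. \<forall>x. y = ereal x \<longrightarrow> P x) (at_right (left_end I))"
      unfolding eventually_at_right[OF less[OF z]]
      using less[OF c(1)] c mem by (intro exI[of _ "ereal c"]) auto
    then show "eventually P (to_left_end I)"
      unfolding to_left_end_def eventually_filtercomap by blast
  qed
qed

lemma eventually_to_right_end_iff:
  fixes I :: "real set"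
  assumes I: "is_interval I" and ne: "I \<noteq> {}" and right: "right_end I \<notin> ereal ` I"
  shows "eventually P (to_right_end I) \<longleftrightarrow> (\<exists>c\<in>I. \<forall>x\<in>I. c < x \<longrightarrow> P x)"
proof -
  obtain z where z: "z \<in> I" using ne by auto
  have less: "ereal x < right_end I" if "x \<in> I" for x
    using that right SUP_upper[of x I ereal] unfolding right_end_def by (metis image_eqI order_le_less)
  have ex: "\<exists>y\<in>I. b < ereal y" if "b < right_end I" for b
    using that unfolding right_end_def by (simp add: less_SUP_iff)
  have mem: "x \<in> I" if x: "ereal x < right_end I" "c < x" "c \<in> I" for x c
  proof -
    obtain y where "y \<in> I" "x < y" using ex[OF x(1)] by auto
    then show ?thesis using mem_is_interval_1_I[OF I, of c y x] x by auto
  qed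
  show ?thesis
  proof
    assume "eventually P (to_right_end I)"
    then obtain Q where Q: "eventually Q (at_left (right_end I))" "\<And>x. Q (ereal x) \<Longrightarrow> P x"
      unfolding to_right_end_def eventually_filtercomap by blast
    then obtain b where b: "b < right_end I" "\<And>y. b < y \<Longrightarrow> y < right_end I \<Longrightarrow> Q y"
      using eventually_at_left[OF less[OF z], of Q] by auto
    obtain c where c: "c \<in> I" "b < ereal c" using ex[OF b(1)] by auto
    have "P x" if "x \<in> I" "c < x" for x
      using Q(2) b(2)[OF _ less[OF that(1)]] c(2) that(2)
      by (meson less_ereal.simps(1) less_trans)
    then show "\<exists>c\<in>I. \<forall>x\<in>I. c < x \<longrightarrow> P x" using c(1) by blast
  next
    assume "\<exists>c\<in>I. \<forall>x\<in>I. c < x \<longrightarrow> P x"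
    then obtain c where c: "c \<in> I" "\<And>x. x \<in> I \<Longrightarrow> c < x \<Longrightarrow> P x" by blast
    have "eventually (\<lambda>y. \<forall>x. y = ereal x \<longrightarrow> P x) (at_left (right_end I))"
      unfolding eventually_at_left[OF less[OF z]]
      using less[OF c(1)] c mem by (intro exI[of _ "ereal c"]) auto
    then show "eventually P (to_right_end I)"
      unfolding to_right_end_def eventually_filtercomap by blast
  qed
qed


section \<open>Plateau functions\<close>

context interval_scale
begin

text \<open>
  The function with derivative \<open>1\<close> in \<open>s\<close> on \<open>{p..q}\<close> and \<open>0\<close> elsewhere. Clamping the argument to
  \<open>{p..q}\<close> makes it monotone on the whole line, hence Borel, whatever \<open>s\<close> is outside \<open>I\<close>.
\<close>

definition ramp :: "real \<Rightarrow> real \<Rightarrow> real \<Rightarrow> real" where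
  "ramp p q x = s (max p (min q x)) - s p"

lemma clamp_mem: "p \<in> I \<Longrightarrow> q \<in> I \<Longrightarrow> max p (min q x) \<in> I \<or> q < p"
  using mem_is_interval_1_I[OF I, of p q "max p (min q x)"] by (auto simp: max_def min_def)

lemma ramp_mono:
  assumes "p \<in> I" "q \<in> I" "p \<le> q" "x \<le> y"
  shows "ramp p q x \<le> ramp p q y"
proof -
  have "max p (min q x) \<in> I" "max p (min q y) \<in> I"
    using clamp_mem[OF assms(1,2)] assms(3) by auto
  then show ?thesis unfolding ramp_def using assms(4) by (intro diff_right_mono s_le) auto
qed

lemma ramp_left: "x \<le> p \<Longrightarrow> ramp p q x = 0"
  by (simp add: ramp_def)

lemma ramp_right: "p \<le> q \<Longrightarrow> q \<le> x \<Longrightarrow> ramp p q x = s q - s p"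
  by (simp add: ramp_def)

lemma ramp_bounds:
  assumes "p \<in> I" "q \<in> I" "p \<le> q"
  shows "0 \<le> ramp p q x" "ramp p q x \<le> s q - s p"
proof -
  show "0 \<le> ramp p q x"
    using ramp_mono[OF assms, of p x] ramp_left[of p p q] ramp_left[of x p q] by (cases "p \<le> x") auto
  show "ramp p q x \<le> s q - s p"
    using ramp_mono[OF assms, of x q] ramp_right[of p q q] ramp_right[of p q x] assms
    by (cases "x \<le> q") auto
qed

lemma ramp_measurable: "p \<in> I \<Longrightarrow> q \<in> I \<Longrightarrow> p \<le> q \<Longrightarrow> ramp p q \<in> borel_measurable borel"
  by (intro borel_measurable_mono monoI ramp_mono)

lemma has_ds_deriv_ramp:
  assumes pq: "p \<in> I" "q \<in> I" "p \<le> q"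
  shows "has_ds_deriv I s (ramp p q) (indicator {p..q})"
  unfolding has_ds_deriv_def
proof (intro ballI impI)
  fix x y assume xy: "x \<in> I" "y \<in> I" "x < y"
  let ?a = "max x p" and ?b = "min y q"
  have ab: "?a \<in> I" "?b \<in> I" using pq xy by (auto simp: max_def min_def)
  have i: "(\<lambda>z. indicator {x..y} z *\<^sub>R indicator {p..q} z) = (indicator {?a..?b} :: real \<Rightarrow> real)"
    by (auto split: split_indicator)
  have fin: "emeasure S {?a..?b} < \<infinity>"
    using emeasure_S[OF ab] by (cases "?a \<le> ?b") auto
  have val: "measure S {?a..?b} = ramp p q y - ramp p q x"
  proof (cases "?a \<le> ?b")
    case True
    then have "p \<le> y" "x \<le> q" by auto
    then have "max p (min q x) = ?a" "max p (min q y) = ?b" using pq by auto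
    then have "ramp p q y - ramp p q x = s ?b - s ?a" by (simp only: ramp_def)
    then show ?thesis
      using emeasure_S[OF ab True] s_le[OF ab True] by (simp add: measure_def)
  next
    case False
    then have "y < p \<or> q < x" using pq xy by (auto simp: max_def min_def split: if_splits)
    then have "ramp p q y = ramp p q x"
      using xy ramp_left[of x p q] ramp_left[of y p q] ramp_right[of p q x] ramp_right[of p q y] pq
      by auto
    then show ?thesis using False by simp
  qed
  show "set_integrable S {x..y} (indicator {p..q} :: real \<Rightarrow> real) \<and>
      ramp p q y - ramp p q x = (LINT z:{x..y}|S. indicator {p..q} z)"
    unfolding set_integrable_def set_lebesgue_integral_def i
    using fin val Icc_sets_S[OF ab] by simp
qed

lemma has_ds_deriv_linear:
  assumes "has_ds_deriv I s u g" "has_ds_deriv I s v h"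
  shows "has_ds_deriv I s (\<lambda>x. c + a * u x + b * v x) (\<lambda>x. a * g x + b * h x)"
  using assms unfolding has_ds_deriv_def
  by (simp add: algebra_simps flip: set_integral_mult_right)

text \<open>
  The plateau rises from \<open>0\<close> to \<open>1\<close> on \<open>{p..q}\<close> and falls from \<open>1\<close> to \<open>0\<close> on \<open>{r..t}\<close>, linearly in
  \<open>s\<close>. If \<open>I\<close> contains its left end-point, \<open>p = q\<close> may be that end-point: the plateau then starts
  there with the value \<open>1\<close>, the quotient being \<open>0 / 0 = 0\<close>. The same applies on the right.
\<close>

definition plateau :: "real \<Rightarrow> real \<Rightarrow> real \<Rightarrow> real \<Rightarrow> real \<Rightarrow> real" where
  "plateau p q r t x = of_bool (p = q) + ramp p q x / (s q - s p) - ramp r t x / (s t - s r)"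

definition plateau_deriv :: "real \<Rightarrow> real \<Rightarrow> real \<Rightarrow> real \<Rightarrow> real \<Rightarrow> real" where
  "plateau_deriv p q r t x = indicator {p..q} x / (s q - s p) - indicator {r..t} x / (s t - s r)"

definition plateau_at :: "real \<Rightarrow> real \<Rightarrow> real \<Rightarrow> real \<Rightarrow> bool" where
  "plateau_at p q r t \<longleftrightarrow> p \<in> I \<and> q \<in> I \<and> r \<in> I \<and> t \<in> I \<and> p \<le> q \<and> q \<le> r \<and> r \<le> t \<and>
     (p = q \<longrightarrow> (\<forall>x\<in>I. p \<le> x)) \<and> (r = t \<longrightarrow> (\<forall>x\<in>I. x \<le> t))"

lemma plateau_eq_1:
  assumes "plateau_at p q r t" "q \<le> x" "x \<le> r"
  shows "plateau p q r t x = 1"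
  using assms s_less[of p q] unfolding plateau_at_def
  by (auto simp: plateau_def ramp_left ramp_right)

lemma plateau_eq_0:
  assumes "plateau_at p q r t" "x \<in> I" "x < p \<or> t < x"
  shows "plateau p q r t x = 0"
  using assms s_less[of p q] s_less[of r t] unfolding plateau_at_def
  by (cases "p = q"; cases "r = t") (auto simp: plateau_def ramp_left ramp_right)

lemma plateau_bounds:
  assumes pl: "plateau_at p q r t"
  shows "0 \<le> plateau p q r t x" "plateau p q r t x \<le> 1"
proof -
  have I: "p \<in> I" "q \<in> I" "r \<in> I" "t \<in> I" and le: "p \<le> q" "q \<le> r" "r \<le> t"
    using pl by (auto simp: plateau_at_def)
  have d: "0 \<le> s q - s p" "0 \<le> s t - s r" using s_le I le by auto
  have A: "0 \<le> ramp p q x / (s q - s p)" "ramp p q x / (s q - s p) \<le> of_bool (p \<noteq> q)"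
    using ramp_bounds[OF I(1,2) le(1), of x] d s_less[OF I(1,2)] le by (auto simp: divide_simps)
  have B: "0 \<le> ramp r t x / (s t - s r)" "ramp r t x / (s t - s r) \<le> 1"
    using ramp_bounds[OF I(3,4) le(3), of x] d by (auto simp: divide_simps)
  show "plateau p q r t x \<le> 1" using A B by (cases "p = q") (auto simp: plateau_def)
  show "0 \<le> plateau p q r t x"
  proof (cases "x \<le> r")
    case True
    then have "ramp r t x = 0" by (rule ramp_left)
    then show ?thesis using A by (simp add: plateau_def)
  next
    case False
    then have "ramp p q x = s q - s p" using le by (intro ramp_right) auto
    then show ?thesis using B s_less[OF I(1,2)] le by (cases "p = q") (auto simp: plateau_def)
  qed
qed

lemma plateau_measurable:
  assumes "plateau_at p q r t"
  shows "plateau p q r t \<in> borel_measurable borel"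
proof -
  have [measurable]: "ramp p q \<in> borel_measurable borel" "ramp r t \<in> borel_measurable borel"
    using assms by (auto simp: plateau_at_def intro: ramp_measurable)
  show ?thesis unfolding plateau_def by measurable
qed

lemma has_ds_deriv_plateau:
  assumes "plateau_at p q r t"
  shows "has_ds_deriv I s (plateau p q r t) (plateau_deriv p q r t)"
proof -
  have "has_ds_deriv I s
     (\<lambda>x. of_bool (p = q) + (1 / (s q - s p)) * ramp p q x + (- 1 / (s t - s r)) * ramp r t x)
     (\<lambda>x. (1 / (s q - s p)) * indicator {p..q} x + (- 1 / (s t - s r)) * indicator {r..t} x)"
    using assms by (intro has_ds_deriv_linear has_ds_deriv_ramp) (auto simp: plateau_at_def)
  then show ?thesis by (simp add: plateau_def[abs_def] plateau_deriv_def[abs_def])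
qed

lemma plateau_integrable:
  assumes pl: "plateau_at p q r t" and k: "radon_measure_on I k"
  shows "integrable k (plateau p q r t)"
proof (rule integrableI_bounded_set[where A = "{p..t}" and B = 1])
  have pt: "p \<in> I" "t \<in> I" using pl by (auto simp: plateau_at_def)
  have sets: "sets k = sets (restrict_space borel I)" using k by (simp add: radon_measure_on_def)
  show "{p..t} \<in> sets k" using Icc_in_sets[OF I pt] sets by simp
  show "plateau p q r t \<in> borel_measurable k"
    unfolding measurable_cong_sets[OF sets refl]
    by (rule measurable_restrict_space1[OF plateau_measurable[OF pl]])
  show "emeasure k {p..t} < \<infinity>"
    using k interval_Icc_subset[OF I pt] by (simp add: radon_measure_on_def)
  show "AE x in k. x \<in> {p..t} \<longrightarrow> norm (plateau p q r t x) \<le> 1"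
    using plateau_bounds[OF pl] by simp
  show "AE x in k. x \<notin> {p..t} \<longrightarrow> plateau p q r t x = 0"
    using plateau_eq_0[OF pl] space_of_borel_sets[OF sets] by (intro AE_I2) auto
qed

lemma plateau_deriv_L2:
  assumes pl: "plateau_at p q r t"
  shows "plateau_deriv p q r t \<in> L2 S"
proof -
  have I: "p \<in> I" "q \<in> I" "r \<in> I" "t \<in> I" and le: "p \<le> q" "q \<le> r" "r \<le> t"
    using pl by (auto simp: plateau_at_def)
  note [measurable] = has_ds_deriv_measurable[OF has_ds_deriv_plateau[OF pl]]
  let ?B = "\<bar>1 / (s q - s p)\<bar> + \<bar>1 / (s t - s r)\<bar>"
  have "integrable S (\<lambda>x. (plateau_deriv p q r t x)\<^sup>2)"
  proof (rule integrableI_bounded_set[where A = "{p..t}" and B = "?B\<^sup>2"])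
    show "{p..t} \<in> sets S" "emeasure S {p..t} < \<infinity>"
      using I le by (auto simp: Icc_sets_S emeasure_S)
    have "\<bar>plateau_deriv p q r t x\<bar> \<le> ?B" for x
      by (rule order_trans[OF abs_triangle_ineq4[of "indicator {p..q} x / (s q - s p)"
            "indicator {r..t} x / (s t - s r)", folded plateau_deriv_def]])
         (auto split: split_indicator)
    then have "\<bar>plateau_deriv p q r t x\<bar>\<^sup>2 \<le> ?B\<^sup>2" for x by (intro power_mono) auto
    then show "AE x in S. x \<in> {p..t} \<longrightarrow> norm ((plateau_deriv p q r t x)\<^sup>2) \<le> ?B\<^sup>2" by simp
    show "AE x in S. x \<notin> {p..t} \<longrightarrow> (plateau_deriv p q r t x)\<^sup>2 = 0"
      using le by (intro AE_I2) (auto simp: plateau_deriv_def split: split_indicator)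
  qed measurable
  then show ?thesis by (simp add: L2_def)
qed

text \<open>
  A plateau vanishes outside a compact subset of \<open>I\<close>: it is integrable for every Radon measure, and it
  vanishes near an end-point that is not in \<open>I\<close>, whether that end-point is regular or not.
\<close>

lemma plateau_mem_dom0:
  assumes pl: "plateau_at p q r t" and m: "radon_measure_on I m" and k: "radon_measure_on I k"
  shows "plateau p q r t \<in> dom0_smk I s m k"
proof -
  let ?u = "plateau p q r t"
  have sm: "sets m = sets (restrict_space borel I)" and sk: "sets k = sets (restrict_space borel I)"
    using m k by (auto simp: radon_measure_on_def)
  have mk: "radon_measure_on I (add_measure m k)"
    unfolding radon_measure_on_def
  proof (intro conjI allI impI)
    fix K assume K: "compact K \<and> K \<subseteq> I"
    then have "K \<in> sets m" unfolding sm sets_restrict_space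
      by (intro image_eqI[of _ _ K]) (auto intro: borel_compact)
    then show "emeasure (add_measure m k) K < \<infinity>"
      using K m k sm sk by (auto simp: emeasure_add_measure radon_measure_on_def)
  qed (simp add: sm)
  have u[measurable]: "?u \<in> borel_measurable (add_measure m k)" and i: "integrable (add_measure m k) ?u"
    using plateau_integrable[OF pl mk] by auto
  have "(?u x)\<^sup>2 \<le> ?u x" for x
    using plateau_bounds[OF pl, of x] by (simp add: power2_eq_square mult_left_le)
  then have "integrable (add_measure m k) (\<lambda>x. (?u x)\<^sup>2)"
    using plateau_bounds[OF pl] by (intro Bochner_Integration.integrable_bound[OF i]) auto
  then have "?u \<in> L2 (add_measure m k)" using u by (simp add: L2_def)
  moreover have "ac_wrt I s ?u" using has_ds_deriv_plateau[OF pl] by (auto simp: ac_wrt_def)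
  moreover have "ds_deriv I s ?u \<in> L2 S"
    using ds_deriv_in_L2_iff[OF has_ds_deriv_plateau[OF pl]] plateau_deriv_L2[OF pl] by simp
  moreover have "(?u \<longlongrightarrow> 0) (to_left_end I)" if "left_end I \<notin> ereal ` I"
  proof (rule tendsto_eventually)
    show "\<forall>\<^sub>F x in to_left_end I. ?u x = 0"
      using that pl plateau_eq_0[OF pl] by (subst eventually_to_left_end_iff[OF I])
        (auto simp: plateau_at_def)
  qed
  moreover have "(?u \<longlongrightarrow> 0) (to_right_end I)" if "right_end I \<notin> ereal ` I"
  proof (rule tendsto_eventually)
    show "\<forall>\<^sub>F x in to_right_end I. ?u x = 0"
      using that pl plateau_eq_0[OF pl] by (subst eventually_to_right_end_iff[OF I])
        (auto simp: plateau_at_def)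
  qed
  ultimately show ?thesis
    by (auto simp: dom0_smk_def dom_smk_def left_regular_def right_regular_def)
qed

end


section \<open>Approximation of compact intervals by plateaus\<close>

context interval_scale
begin

text \<open>
  The corners of plateaus decreasing to the indicator of an interval \<open>{q..r}\<close>. On \<open>{p'..P n}\<close> a second,
  wider plateau can rise that is \<open>1\<close> wherever the first one is not \<open>0\<close>. If \<open>q\<close> is the left end-point of
  \<open>I\<close>, both start at \<open>q\<close> with the value \<open>1\<close>.
\<close>

lemma left_approximation:
  assumes q: "q \<in> I"
  obtains p' P where "p' \<in> I" "\<And>n::nat. P n \<in> I" "\<And>n. p' \<le> P n" "\<And>n. P n \<le> q"
    "\<And>n. P n = q \<Longrightarrow> \<forall>x\<in>I. q \<le> x" "\<And>n. p' = P n \<Longrightarrow> \<forall>x\<in>I. p' \<le> x"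
    "incseq P" "P \<longlonglongrightarrow> q"
proof (cases "\<exists>x\<in>I. x < q")
  case True
  then obtain x where x: "x \<in> I" "x < q" by blast
  define P where "P n = q - (q - x) / (real n + 2)" for n
  have P: "x < P n" "P n < q" for n
  proof -
    have "(q - x) / (real n + 2) \<le> (q - x) / 2" using x(2) by (intro divide_left_mono) auto
    then show "x < P n" using x(2) by (simp add: P_def field_simps)
    show "P n < q" using x(2) by (simp add: P_def)
  qed
  show ?thesis
  proof (rule that[of x P])
    show "P n \<in> I" for n using mem_is_interval_1_I[OF I x(1) q, of "P n"] P[of n] by simp
    show "incseq P" unfolding P_def incseq_def using x(2)
      by (intro allI impI diff_left_mono divide_left_mono) auto
    have "(\<lambda>n. q - (q - x) / real (n + 2)) \<longlonglongrightarrow> q - 0"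
      by (intro tendsto_intros LIMSEQ_ignore_initial_segment[OF lim_const_over_n])
    then show "P \<longlonglongrightarrow> q" by (simp add: P_def[abs_def] add.commute)
  qed (use x P in \<open>auto simp: less_imp_le dest: less_imp_neq\<close>)
next
  case False
  then show ?thesis using q by (intro that[of q "\<lambda>n. q"]) (auto simp: incseq_def not_less)
qed

lemma right_approximation:
  assumes r: "r \<in> I"
  obtains t' T where "t' \<in> I" "\<And>n::nat. T n \<in> I" "\<And>n. T n \<le> t'" "\<And>n. r \<le> T n"
    "\<And>n. r = T n \<Longrightarrow> \<forall>x\<in>I. x \<le> r" "\<And>n. T n = t' \<Longrightarrow> \<forall>x\<in>I. x \<le> t'"
    "decseq T" "T \<longlonglongrightarrow> r"
proof (cases "\<exists>x\<in>I. r < x")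
  case True
  then obtain x where x: "x \<in> I" "r < x" by blast
  define T where "T n = r + (x - r) / (real n + 2)" for n
  have T: "T n < x" "r < T n" for n
  proof -
    have "(x - r) / (real n + 2) \<le> (x - r) / 2" using x(2) by (intro divide_left_mono) auto
    then show "T n < x" using x(2) by (simp add: T_def field_simps)
    show "r < T n" using x(2) by (simp add: T_def)
  qed
  show ?thesis
  proof (rule that[of x T])
    show "T n \<in> I" for n using mem_is_interval_1_I[OF I r x(1), of "T n"] T[of n] by simp
    show "decseq T" unfolding T_def decseq_def using x(2)
      by (intro allI impI add_left_mono divide_left_mono) auto
    have "(\<lambda>n. r + (x - r) / real (n + 2)) \<longlonglongrightarrow> r + 0"
      by (intro tendsto_intros LIMSEQ_ignore_initial_segment[OF lim_const_over_n])
    then show "T \<longlonglongrightarrow> r" by (simp add: T_def[abs_def] add.commute)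
  qed (use x T in \<open>auto simp: less_imp_le dest: less_imp_neq\<close>)
next
  case False
  then show ?thesis using r by (intro that[of r "\<lambda>n. r"]) (auto simp: decseq_def not_less)
qed

text \<open>
  The integral of a plateau lies between the measures of \<open>{q..r}\<close> and \<open>{p..t}\<close>, and \<open>{p..t}\<close> can be
  shrunk to \<open>{q..r}\<close>. Each plateau comes with a wider one: the second argument that a form
  needs to turn into the integral of the first.
\<close>

lemma emeasure_le_of_plateau_integrals:
  assumes k: "radon_measure_on I k" and k': "radon_measure_on I k'"
    and eq: "\<And>p q r t p' t'. plateau_at p q r t \<Longrightarrow> plateau_at p' p t t' \<Longrightarrow>
      (\<integral>x. plateau p q r t x \<partial>k) = (\<integral>x. plateau p q r t x \<partial>k')"
    and qr: "q \<in> I" "r \<in> I" "q \<le> r"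
  shows "emeasure k {q..r} \<le> emeasure k' {q..r}"
proof -
  have sk: "sets k = sets (restrict_space borel I)" and sk': "sets k' = sets (restrict_space borel I)"
    using k k' by (auto simp: radon_measure_on_def)
  obtain p' P where P: "p' \<in> I" "\<And>n::nat. P n \<in> I" "\<And>n. p' \<le> P n" "\<And>n. P n \<le> q"
    "\<And>n. P n = q \<Longrightarrow> \<forall>x\<in>I. q \<le> x" "\<And>n. p' = P n \<Longrightarrow> \<forall>x\<in>I. p' \<le> x" "incseq P" "P \<longlonglongrightarrow> q"
    by (rule left_approximation[OF qr(1)]) blast
  obtain t' T where T: "t' \<in> I" "\<And>n::nat. T n \<in> I" "\<And>n. T n \<le> t'" "\<And>n. r \<le> T n"
    "\<And>n. r = T n \<Longrightarrow> \<forall>x\<in>I. x \<le> r" "\<And>n. T n = t' \<Longrightarrow> \<forall>x\<in>I. x \<le> t'" "decseq T" "T \<longlonglongrightarrow> r"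
    by (rule right_approximation[OF qr(2)]) blast
  let ?J = "\<lambda>n. {P n..T n}"
  have PT: "P n \<le> T n" for n using P(4)[of n] T(4)[of n] qr(3) by simp
  have le: "emeasure k {q..r} \<le> emeasure k' (?J n)" for n
  proof -
    let ?u = "plateau (P n) q r (T n)"
    have pl: "plateau_at (P n) q r (T n)"
      using P(2,4,5)[of n] T(2,4,5)[of n] qr by (auto simp: plateau_at_def)
    have pl': "plateau_at p' (P n) (T n) t'"
      using P(1) P(2,3,6)[of n] T(1) T(2,3,6)[of n] PT[of n] by (auto simp: plateau_at_def)
    have J: "{q..r} \<in> sets k" "?J n \<in> sets k'"
      using Icc_in_sets[OF I] qr P(2) T(2) sk sk' by auto
    have "emeasure k {q..r} = (\<integral>\<^sup>+x. indicator {q..r} x \<partial>k)" using J by simp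
    also have "\<dots> \<le> (\<integral>\<^sup>+x. ennreal (?u x) \<partial>k)"
      using plateau_eq_1[OF pl] by (intro nn_integral_mono) (auto split: split_indicator)
    also have "\<dots> = ennreal (\<integral>x. ?u x \<partial>k)"
      using plateau_integrable[OF pl k] plateau_bounds[OF pl] by (intro nn_integral_eq_integral) auto
    also have "\<dots> = ennreal (\<integral>x. ?u x \<partial>k')" using eq[OF pl pl'] by simp
    also have "\<dots> = (\<integral>\<^sup>+x. ennreal (?u x) \<partial>k')"
      using plateau_integrable[OF pl k'] plateau_bounds[OF pl]
      by (intro nn_integral_eq_integral[symmetric]) auto
    also have "\<dots> \<le> (\<integral>\<^sup>+x. indicator (?J n) x \<partial>k')"
      using plateau_eq_0[OF pl] plateau_bounds[OF pl] space_of_borel_sets[OF sk']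
      by (intro nn_integral_mono) (auto split: split_indicator)
    also have "\<dots> = emeasure k' (?J n)" using J by simp
    finally show ?thesis .
  qed
  have Int: "(\<Inter>n. ?J n) = {q..r}"
  proof (intro equalityI subsetI)
    fix x assume "x \<in> (\<Inter>n. ?J n)"
    then have "P n \<le> x" "x \<le> T n" for n by auto
    then have "q \<le> x" "x \<le> r" using LIMSEQ_le_const2[OF P(8)] LIMSEQ_le_const[OF T(8)] by blast+
    then show "x \<in> {q..r}" by simp
  next
    fix x assume "x \<in> {q..r}"
    then show "x \<in> (\<Inter>n. ?J n)" using P(4) T(4) by (auto intro: order_trans)
  qed
  have "(\<lambda>n. emeasure k' (?J n)) \<longlonglongrightarrow> emeasure k' (\<Inter>n. ?J n)"
  proof (rule Lim_emeasure_decseq)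
    show "range ?J \<subseteq> sets k'" using Icc_in_sets[OF I] P(2) T(2) sk' by auto
    show "decseq ?J"
      using P(7) T(7) unfolding decseq_def incseq_def by (fastforce intro: order_trans)
    show "emeasure k' (?J n) \<noteq> \<infinity>" for n
    proof -
      have "emeasure k' (?J n) < \<infinity>"
        using k' interval_Icc_subset[OF I P(2) T(2), of n n] by (simp add: radon_measure_on_def)
      then show ?thesis by simp
    qed
  qed
  then show ?thesis unfolding Int by (rule LIMSEQ_le_const) (use le in blast)
qed

lemma radon_measure_eqI_plateau:
  assumes "radon_measure_on I k" "radon_measure_on I k'"
    and "\<And>p q r t p' t'. plateau_at p q r t \<Longrightarrow> plateau_at p' p t t' \<Longrightarrow>
      (\<integral>x. plateau p q r t x \<partial>k) = (\<integral>x. plateau p q r t x \<partial>k')"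
  shows "k = k'"
proof (rule measure_eqI_Icc[OF I])
  show "sets k = sets (restrict_space borel I)" "sets k' = sets (restrict_space borel I)"
    using assms by (auto simp: radon_measure_on_def)
  fix p q assume pq: "p \<in> I" "q \<in> I" "p \<le> q"
  show "emeasure k {p..q} = emeasure k' {p..q}"
  proof (rule antisym)
    show "emeasure k {p..q} \<le> emeasure k' {p..q}"
      using assms pq by (intro emeasure_le_of_plateau_integrals) auto
    show "emeasure k' {p..q} \<le> emeasure k {p..q}"
      using assms pq by (intro emeasure_le_of_plateau_integrals) (auto simp: assms(3))
  qed
  show "emeasure k {p..q} < \<infinity>"
    using assms(1) interval_Icc_subset[OF I pq(1,2)] by (simp add: radon_measure_on_def)
qed

end


section \<open>A change of scale with a density\<close>

text \<open>
  On \<open>{p..q}\<close> a plateau is an affine function of \<open>s\<^sub>2\<close> with slope \<open>c > 0\<close>. As a member of the larger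
  domain it has a derivative \<open>h\<close> in \<open>s\<^sub>1\<close>. Therefore \<open>c \<cdot> ds\<^sub>2 = h \<cdot> ds\<^sub>1\<close> on \<open>{p..q}\<close>, and null sets of
  \<open>ds\<^sub>1\<close> are null sets of \<open>ds\<^sub>2\<close>.
\<close>

lemma absolutely_continuous_of_dom0_subset:
  assumes sc1: "interval_scale I s1" and sc2: "interval_scale I s2"
    and m: "radon_measure_on I m" and k2: "radon_measure_on I k2"
    and sub: "dom0_smk I s2 m k2 \<subseteq> dom0_smk I s1 m k1"
  shows "absolutely_continuous (stieltjes I s1) (stieltjes I s2)"
proof -
  interpret S1: interval_scale I s1 by fact
  interpret S2: interval_scale I s2 by fact
  have setsN: "sets S2.S = sets S1.S" using S1.sets_S S2.sets_S by simp
  have null: "A \<inter> {p..q} \<in> null_sets S2.S"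
    if A: "A \<in> null_sets S1.S" and pq: "p \<in> I" "q \<in> I" "p < q" for A p q
  proof -
    obtain r t where pl: "S2.plateau_at p q r t"
    proof (cases "\<exists>y\<in>I. q < y")
      case True
      then obtain y where "y \<in> I" "q < y" by blast
      then show ?thesis using pq by (intro that[of q y]) (auto simp: S2.plateau_at_def)
    next
      case False
      then show ?thesis using pq by (intro that[of q q]) (auto simp: S2.plateau_at_def not_less)
    qed
    let ?u = "S2.plateau p q r t" and ?c = "1 / (s2 q - s2 p)"
    have c: "0 < ?c" using S2.s_less[OF pq] by simp
    have "?u \<in> dom0_smk I s1 m k1" using S2.plateau_mem_dom0[OF pl m k2] sub by blast
    then obtain h where h: "has_ds_deriv I s1 ?u h"
      by (auto simp: dom0_smk_def dom_smk_def ac_wrt_def)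
    have incr: "?u y - ?u x = ?c * (s2 y - s2 x)" if "p \<le> x" "x \<le> y" "y \<le> q" for x y
    proof -
      have "q \<le> r" using pl by (simp add: S2.plateau_at_def)
      then have "S2.ramp r t x = 0" "S2.ramp r t y = 0" using that by (auto intro: S2.ramp_left)
      moreover have "S2.ramp p q x = s2 x - s2 p" "S2.ramp p q y = s2 y - s2 p"
        using that by (simp_all add: S2.ramp_def max_absorb2 min_absorb2)
      ultimately show ?thesis by (simp add: S2.plateau_def flip: diff_divide_distrib)
    qed
    note [measurable] = S1.has_ds_deriv_measurable[OF h]
    have K1[measurable]: "{p..q} \<in> sets S1.S" and K2[measurable]: "{p..q} \<in> sets S2.S"
      using S1.Icc_sets_S S2.Icc_sets_S pq by auto
    let ?h = "\<lambda>x. indicator {p..q} x * h x"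
    let ?N = "density S2.S (\<lambda>x. ennreal ?c * indicator {p..q} x)"
    have N: "emeasure ?N B = ennreal ?c * emeasure S2.S (B \<inter> {p..q})" if [measurable]: "B \<in> sets S2.S" for B
    proof -
      have "emeasure ?N B = (\<integral>\<^sup>+x. ennreal ?c * indicator (B \<inter> {p..q}) x \<partial>S2.S)"
        by (subst emeasure_density) (auto intro!: nn_integral_cong split: split_indicator)
      also have "\<dots> = ennreal ?c * emeasure S2.S (B \<inter> {p..q})"
        by (rule nn_integral_cmult_indicator) measurable
      finally show ?thesis .
    qed
    have eq: "add_measure ?N (density S1.S (\<lambda>x. ennreal (- ?h x))) = density S1.S (\<lambda>x. ennreal (?h x))"
    proof (rule add_density_neg_eq_density_pos[OF S1.I])
      fix x y assume xy: "x \<in> I" "y \<in> I" "x \<le> y"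
      let ?a = "max x p" and ?b = "min y q"
      have ab: "?a \<in> I" "?b \<in> I" using pq xy by (auto simp: max_def min_def)
      have i: "(\<lambda>z. indicator {x..y} z *\<^sub>R ?h z) = (\<lambda>z. indicator {?a..?b} z *\<^sub>R h z)"
        by (auto split: split_indicator)
      have K: "{x..y} \<inter> {p..q} = {?a..?b}" by auto
      have xyS: "{x..y} \<in> sets S2.S" using S2.Icc_sets_S xy by simp
      have "set_integrable S1.S {x..y} ?h \<and>
        emeasure ?N {x..y} = ennreal (LINT z:{x..y}|S1.S. ?h z) \<and> 0 \<le> (LINT z:{x..y}|S1.S. ?h z)"
      proof (cases "?a \<le> ?b")
        case True
        note hi = S1.has_ds_deriv_set_integrable[OF h ab True]
        have L: "(LINT z:{x..y}|S1.S. ?h z) = ?c * (s2 ?b - s2 ?a)"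
          using hi(2) incr[OF _ True] unfolding set_lebesgue_integral_def i by simp
        moreover have d: "0 \<le> s2 ?b - s2 ?a" using S2.s_le[OF ab True] by simp
        moreover have "emeasure ?N {x..y} = ennreal (?c * (s2 ?b - s2 ?a))"
          unfolding N[OF xyS] K S2.emeasure_S[OF ab True] using c d by (intro ennreal_mult[symmetric]) auto
        moreover have "set_integrable S1.S {x..y} ?h"
          using hi(1) unfolding set_integrable_def i .
        ultimately show ?thesis using c by simp
      next
        case False
        then show ?thesis unfolding N[OF xyS] K set_integrable_def set_lebesgue_integral_def i by simp
      qed
      then show "set_integrable S1.S {x..y} ?h"
        "emeasure ?N {x..y} = ennreal (LINT z:{x..y}|S1.S. ?h z) \<and> 0 \<le> (LINT z:{x..y}|S1.S. ?h z)"
        by auto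
    qed (use S1.sets_S S2.sets_S in auto)
    have AS: "A \<in> sets S1.S" "A \<in> sets S2.S" using A setsN by auto
    have "A \<in> null_sets (density S1.S (\<lambda>x. ennreal (?h x)))"
      using AS(1) AE_not_in[OF A] by (subst null_sets_density_iff) auto
    then have "emeasure (density S1.S (\<lambda>x. ennreal (?h x))) A = 0" by auto
    then have "emeasure (add_measure ?N (density S1.S (\<lambda>x. ennreal (- ?h x)))) A = 0" unfolding eq .
    then have "emeasure ?N A = 0" using AS setsN by (simp add: emeasure_add_measure)
    then have "emeasure S2.S (A \<inter> {p..q}) = 0" using N[OF AS(2)] c by simp
    then show ?thesis using AS(2) K2 by (simp add: null_sets_def)
  qed
  obtain C where C: "countable C" "\<Union>C = I"
    "\<And>X. X \<in> C \<Longrightarrow> \<exists>p\<in>I. \<exists>q\<in>I. p \<le> q \<and> X = {p..q}"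
    by (rule countable_Icc_cover[OF S1.I]) blast
  show ?thesis
    unfolding absolutely_continuous_def
  proof
    fix A assume A: "A \<in> null_sets S1.S"
    have "A \<inter> X \<in> null_sets S2.S" if X: "X \<in> C" for X
    proof -
      obtain p q where pq: "p \<in> I" "q \<in> I" "p \<le> q" "X = {p..q}" using C(3)[OF X] by blast
      show ?thesis
      proof (cases "p = q")
        case True
        then have "{p..q} \<in> null_sets S2.S"
          using pq S2.emeasure_S[of p q] S2.Icc_sets_S[of p q] by (simp add: null_sets_def)
        then show ?thesis using A setsN pq(4) by (intro null_set_Int1) auto
      next
        case False
        then show ?thesis using null[OF A pq(1,2)] pq(3,4) by simp
      qed
    qed
    then have "(\<Union>X\<in>C. A \<inter> X) \<in> null_sets S2.S" by (rule null_sets_UN'[OF C(1)])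
    moreover have "A \<subseteq> I" using A sets.sets_into_space[of A S1.S] S1.space_S by auto
    then have "(\<Union>X\<in>C. A \<inter> X) = A" using C(2) by blast
    ultimately show "A \<in> null_sets S2.S" by simp
  qed
qed


text \<open>
  Two scale functions with \<open>ds\<^sub>2 = f \<cdot> ds\<^sub>1\<close>, where the density is taken to be real-valued and nonnegative
  everywhere, so that it can be multiplied with derivatives.
\<close>

locale scale_density = S1: interval_scale I s1 + S2: interval_scale I s2 for I s1 s2 +
  fixes f :: "real \<Rightarrow> real"
  assumes f_measurable: "f \<in> borel_measurable (stieltjes I s1)"
    and f_nonneg: "\<And>x. 0 \<le> f x"
    and density_f: "stieltjes I s2 = density (stieltjes I s1) (\<lambda>x. ennreal (f x))"

lemma scale_density_RN_deriv:
  assumes "interval_scale I s1" "interval_scale I s2"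
    and ac: "absolutely_continuous (stieltjes I s1) (stieltjes I s2)"
  defines "f \<equiv> \<lambda>x. enn2real (RN_deriv (stieltjes I s1) (stieltjes I s2) x)"
  shows "scale_density I s1 s2 f"
    and "AE x in stieltjes I s1. RN_deriv (stieltjes I s1) (stieltjes I s2) x = ennreal (f x)"
proof -
  interpret S1: interval_scale I s1 by fact
  interpret S2: interval_scale I s2 by fact
  let ?R = "RN_deriv S1.S S2.S"
  have sets: "sets S2.S = sets S1.S" using S1.sets_S S2.sets_S by simp
  have "AE x in S1.S. ?R x \<noteq> \<infinity>"
    by (rule S1.RN_deriv_finite[OF _ ac sets]) unfold_locales
  then show AE: "AE x in S1.S. ?R x = ennreal (f x)"
    by eventually_elim (auto simp: f_def less_top)
  have [measurable]: "f \<in> borel_measurable S1.S" unfolding f_def by measurable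
  have "S2.S = density S1.S ?R" using S1.density_RN_deriv[OF ac sets] by simp
  also have "\<dots> = density S1.S (\<lambda>x. ennreal (f x))" using AE by (intro density_cong) auto
  finally show "scale_density I s1 s2 f"
    by unfold_locales (simp_all add: f_def)
qed

context scale_density
begin

lemma sets_S12: "sets S2.S = sets S1.S"
  using S1.sets_S S2.sets_S by simp

lemma measurable_S12: "(borel_measurable S2.S :: (real \<Rightarrow> real) set) = borel_measurable S1.S"
  using sets_S12 by (intro measurable_cong_sets) auto

lemma integral_S2:
  assumes "g \<in> borel_measurable S1.S"
  shows "(\<integral>x. g x \<partial>S2.S) = (\<integral>x. f x * g x \<partial>S1.S)"
  unfolding density_f using assms f_measurable f_nonneg by (subst integral_density) auto

lemma integrable_S2:
  fixes g :: "real \<Rightarrow> real"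
  assumes "g \<in> borel_measurable S1.S"
  shows "integrable S2.S g \<longleftrightarrow> integrable S1.S (\<lambda>x. f x * g x)"
  unfolding density_f using assms f_measurable f_nonneg by (subst integrable_density) auto

text \<open>The chain rule \<open>du/ds\<^sub>1 = (ds\<^sub>2/ds\<^sub>1) (du/ds\<^sub>2)\<close>.\<close>

lemma has_ds_deriv_change_scale:
  assumes "has_ds_deriv I s2 u g"
  shows "has_ds_deriv I s1 u (\<lambda>x. f x * g x)"
proof -
  have g[measurable]: "g \<in> borel_measurable S1.S"
    using S2.has_ds_deriv_measurable[OF assms] unfolding measurable_S12 .
  show ?thesis
    unfolding has_ds_deriv_def
  proof (intro ballI impI)
    fix x y assume xy: "x \<in> I" "y \<in> I" "x < y"
    have [measurable]: "{x..y} \<in> sets S1.S" using S1.Icc_sets_S xy by simp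
    let ?g = "\<lambda>z. indicator {x..y} z *\<^sub>R g z"
    have m: "?g \<in> borel_measurable S1.S" by measurable
    have e: "(\<lambda>z. f z * ?g z) = (\<lambda>z. indicator {x..y} z *\<^sub>R (f z * g z))"
      by (auto split: split_indicator)
    show "set_integrable S1.S {x..y} (\<lambda>z. f z * g z) \<and>
        u y - u x = (LINT z:{x..y}|S1.S. f z * g z)"
      using S2.has_ds_deriv_set_integrable[OF assms xy(1,2)] xy(3)
      unfolding set_integrable_def set_lebesgue_integral_def integral_S2[OF m] integrable_S2[OF m] e
      by simp
  qed
qed

text \<open>
  Both energies as integrals against \<open>ds\<^sub>1\<close>: they differ only in the weight of the product of the
  derivatives, which is \<open>f\<close> for \<open>s\<^sub>2\<close> and \<open>f\<^sup>2\<close> for \<open>s\<^sub>1\<close>.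
\<close>

lemma form_smk_change_scale:
  assumes g: "has_ds_deriv I s2 u g" and g': "has_ds_deriv I s2 v g'"
  shows "form_smk I s2 k u v = (\<integral>x. f x * (g x * g' x) \<partial>S1.S) + (\<integral>x. u x * v x \<partial>k)"
    and "form_smk I s1 k u v = (\<integral>x. (f x)\<^sup>2 * (g x * g' x) \<partial>S1.S) + (\<integral>x. u x * v x \<partial>k)"
proof -
  note [measurable] = S2.has_ds_deriv_measurable[OF g, unfolded measurable_S12]
    S2.has_ds_deriv_measurable[OF g', unfolded measurable_S12]
  show "form_smk I s2 k u v = (\<integral>x. f x * (g x * g' x) \<partial>S1.S) + (\<integral>x. u x * v x \<partial>k)"
    unfolding S2.form_smk_eq[OF g g'] by (subst integral_S2) auto
  show "form_smk I s1 k u v = (\<integral>x. (f x)\<^sup>2 * (g x * g' x) \<partial>S1.S) + (\<integral>x. u x * v x \<partial>k)"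
    unfolding S1.form_smk_eq[OF has_ds_deriv_change_scale[OF g] has_ds_deriv_change_scale[OF g']]
    by (simp add: power2_eq_square mult_ac)
qed


section \<open>Equal forms have equal killing measures and a density in \<open>{0, 1}\<close>\<close>

text \<open>
  If \<open>v = 1\<close> wherever \<open>u \<noteq> 0\<close>, the energy integrals of \<open>(u, v)\<close> vanish for both scales, and the equality
  of the forms reduces to the equality of the integrals of \<open>u\<close> with respect to the killing measures.
\<close>

lemma killing_measures_eq:
  assumes m: "radon_measure_on I m" and k1: "radon_measure_on I k1" and k2: "radon_measure_on I k2"
    and eq: "\<And>u v. u \<in> dom0_smk I s2 m k2 \<Longrightarrow> v \<in> dom0_smk I s2 m k2 \<Longrightarrow>
      form_smk I s1 k1 u v = form_smk I s2 k2 u v"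
  shows "k1 = k2"
proof (rule S2.radon_measure_eqI_plateau[OF k1 k2])
  fix p q r t p' t' assume pl: "S2.plateau_at p q r t" and pl': "S2.plateau_at p' p t t'"
  let ?u = "S2.plateau p q r t" and ?v = "S2.plateau p' p t t'"
  let ?g = "S2.plateau_deriv p q r t" and ?h = "S2.plateau_deriv p' p t t'"
  note g = S2.has_ds_deriv_plateau[OF pl] and h = S2.has_ds_deriv_plateau[OF pl']
  note [measurable] = f_measurable S2.has_ds_deriv_measurable[OF g, unfolded measurable_S12]
    S2.has_ds_deriv_measurable[OF h, unfolded measurable_S12]
  \<comment> \<open>The derivatives of \<open>u\<close> and \<open>v\<close> have no common point in their supports except \<open>p\<close> and \<open>t\<close>.\<close>
  have "AE x in S1.S. ?g x * ?h x = 0"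
    using S1.AE_S_neq[of p] S1.AE_S_neq[of t]
  proof eventually_elim
    case (elim x)
    then show ?case using pl pl'
      by (auto simp: S2.plateau_at_def S2.plateau_deriv_def split: split_indicator)
  qed
  then have "(\<integral>x. f x * (?g x * ?h x) \<partial>S1.S) = 0" "(\<integral>x. (f x)\<^sup>2 * (?g x * ?h x) \<partial>S1.S) = 0"
    by (auto intro!: integral_eq_zero_AE)
  moreover have uv: "(\<integral>x. ?u x * ?v x \<partial>k) = (\<integral>x. ?u x \<partial>k)" if "radon_measure_on I k" for k
  proof (rule Bochner_Integration.integral_cong)
    fix x assume "x \<in> space k"
    then have "x \<in> I" using that space_of_borel_sets[of k I] by (simp add: radon_measure_on_def)
    then show "?u x * ?v x = ?u x"
      using S2.plateau_eq_1[OF pl', of x] S2.plateau_eq_0[OF pl, of x] by fastforce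
  qed simp
  ultimately show "(\<integral>x. ?u x \<partial>k1) = (\<integral>x. ?u x \<partial>k2)"
    using eq[OF S2.plateau_mem_dom0[OF pl m k2] S2.plateau_mem_dom0[OF pl' m k2]] k1 k2
    unfolding form_smk_change_scale[OF g h] by simp
qed

text \<open>
  Two plateaus whose derivatives overlap only on \<open>{p..q}\<close> isolate the energy of that interval. Equality
  of the forms then says that \<open>f\<^sup>2\<close> and \<open>f\<close> have the same integral over \<open>{p..q}\<close>, and this
  for all \<open>p < q\<close> forces \<open>f\<^sup>2 = f\<close> almost everywhere.
\<close>

lemma density_0_or_1:
  assumes m: "radon_measure_on I m" and k: "radon_measure_on I k"
    and eq: "\<And>u v. u \<in> dom0_smk I s2 m k \<Longrightarrow> v \<in> dom0_smk I s2 m k \<Longrightarrow>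
      form_smk I s1 k u v = form_smk I s2 k u v"
  shows "AE x in S1.S. f x = 0 \<or> f x = 1"
proof -
  note [measurable] = f_measurable
  have sq: "emeasure (density S1.S (\<lambda>x. ennreal ((f x)\<^sup>2))) {p..q} = emeasure S2.S {p..q}"
    if pq: "p \<in> I" "q \<in> I" "p < q" for p q
  proof -
    have [measurable]: "{p..q} \<in> sets S1.S" using S1.Icc_sets_S pq by simp
    \<comment> \<open>Two plateaus that rise together and fall on disjoint intervals, or, if \<open>q\<close> is the right
      end-point, do not fall at all.\<close>
    obtain r t r' t' where pl: "S2.plateau_at p q r t" and pl': "S2.plateau_at p q r' t'"
      and rt: "(t \<le> r' \<and> r < t) \<or> (r = t \<and> r' = t')"
    proof (cases "\<exists>y\<in>I. q < y")
      case True
      then obtain y where y: "y \<in> I" "q < y" by blast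
      then have "(q + y) / 2 \<in> I" using mem_is_interval_1_I[OF S1.I pq(2) y(1)] by simp
      then show ?thesis using pq y
        by (intro that[of q "(q + y) / 2" "(q + y) / 2" y]) (auto simp: S2.plateau_at_def)
    next
      case False
      then show ?thesis using pq
        by (intro that[of q q q q]) (auto simp: S2.plateau_at_def not_less)
    qed
    let ?u = "S2.plateau p q r t" and ?v = "S2.plateau p q r' t'"
    let ?g = "S2.plateau_deriv p q r t" and ?h = "S2.plateau_deriv p q r' t'"
    note g = S2.has_ds_deriv_plateau[OF pl] and h = S2.has_ds_deriv_plateau[OF pl']
    note [measurable] = S2.has_ds_deriv_measurable[OF g, unfolded measurable_S12]
      S2.has_ds_deriv_measurable[OF h, unfolded measurable_S12]
    let ?d = "s2 q - s2 p"
    have d: "0 < ?d" using S2.s_less[OF pq] by simp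
    have gh: "AE x in S1.S. ?g x * ?h x = indicator {p..q} x / ?d\<^sup>2"
      using S1.AE_S_neq[of q] S1.AE_S_neq[of t]
    proof eventually_elim
      case (elim x)
      then show ?case using pl pl' rt
        by (auto simp: S2.plateau_at_def S2.plateau_deriv_def power2_eq_square split: split_indicator)
    qed
    have "(\<integral>x. (f x)\<^sup>2 * (?g x * ?h x) \<partial>S1.S) = (\<integral>x. f x * (?g x * ?h x) \<partial>S1.S)"
      using eq[OF S2.plateau_mem_dom0[OF pl m k] S2.plateau_mem_dom0[OF pl' m k]]
      unfolding form_smk_change_scale[OF g h] by simp
    moreover have "(\<integral>x. (f x)\<^sup>2 * (?g x * ?h x) \<partial>S1.S) = (\<integral>x. (f x)\<^sup>2 * indicator {p..q} x / ?d\<^sup>2 \<partial>S1.S)"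
      using gh by (intro integral_cong_AE) auto
    moreover have "(\<integral>x. f x * (?g x * ?h x) \<partial>S1.S) = (\<integral>x. f x * indicator {p..q} x / ?d\<^sup>2 \<partial>S1.S)"
      using gh by (intro integral_cong_AE) auto
    ultimately have "(\<integral>x. (f x)\<^sup>2 * indicator {p..q} x \<partial>S1.S) = (\<integral>x. f x * indicator {p..q} x \<partial>S1.S)"
      using d by simp
    also have "\<dots> = measure S2.S {p..q}"
      by (subst integral_S2[symmetric]) (auto simp: sets_S12)
    also have "\<dots> = ?d" using S2.emeasure_S[of p q] pq d by (simp add: measure_def)
    finally have L: "(\<integral>x. (f x)\<^sup>2 * indicator {p..q} x \<partial>S1.S) = ?d" .
    \<comment> \<open>As the default value of a divergent integral is \<open>0\<close>, this one converges.\<close>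
    have "integrable S1.S (\<lambda>x. (f x)\<^sup>2 * indicator {p..q} x)"
      using L d not_integrable_integral_eq by fastforce
    then have "(\<integral>\<^sup>+x. ennreal ((f x)\<^sup>2 * indicator {p..q} x) \<partial>S1.S) = ennreal ?d"
      using L by (subst nn_integral_eq_integral) auto
    then show ?thesis
      using S2.emeasure_S[of p q] pq
      by (simp add: emeasure_density ennreal_mult' ennreal_indicator)
  qed
  have "density S1.S (\<lambda>x. ennreal ((f x)\<^sup>2)) = S2.S"
  proof (rule measure_eqI_Icc[OF S1.I])
    fix p q assume pq: "p \<in> I" "q \<in> I" "p \<le> q"
    show e: "emeasure (density S1.S (\<lambda>x. ennreal ((f x)\<^sup>2))) {p..q} = emeasure S2.S {p..q}"
    proof (cases "p = q")
      case True
      have "{p..q} \<in> null_sets S1.S"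
        using True pq S1.emeasure_S[of p q] S1.Icc_sets_S[of p q] by (simp add: null_sets_def)
      then have "{p..q} \<in> null_sets (density S1.S (\<lambda>x. ennreal ((f x)\<^sup>2)))"
        using AE_not_in[OF \<open>{p..q} \<in> null_sets S1.S\<close>]
        by (subst null_sets_density_iff) (auto elim!: eventually_mono)
      then show ?thesis using True pq S2.emeasure_S[of p q] by (auto simp: null_sets_def)
    qed (use sq pq in auto)
    show "emeasure (density S1.S (\<lambda>x. ennreal ((f x)\<^sup>2))) {p..q} < \<infinity>"
      unfolding e using S2.emeasure_S[OF pq] by simp
  qed (auto simp: S1.sets_S S2.sets_S)
  then have "density S1.S (\<lambda>x. ennreal ((f x)\<^sup>2)) = density S1.S (\<lambda>x. ennreal (f x))"
    unfolding density_f .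
  then have "AE x in S1.S. ennreal ((f x)\<^sup>2) = ennreal (f x)"
    by (subst (asm) S1.density_unique_iff) auto
  then show ?thesis
  proof eventually_elim
    case (elim x)
    then show ?case using f_nonneg[of x] by (simp add: power2_eq_square)
  qed
qed


section \<open>A density in \<open>{0, 1}\<close> gives a regular subspace\<close>

lemma s2_increment_le:
  assumes f: "AE x in S1.S. f x = 0 \<or> f x = 1" and xy: "x \<in> I" "y \<in> I" "x \<le> y"
  shows "s2 y - s2 x \<le> s1 y - s1 x"
proof -
  note [measurable] = f_measurable
  have [measurable]: "{x..y} \<in> sets S1.S" using S1.Icc_sets_S xy by simp
  have "emeasure S2.S {x..y} = (\<integral>\<^sup>+z. ennreal (f z) * indicator {x..y} z \<partial>S1.S)"
    unfolding density_f by (subst emeasure_density) auto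
  also have "\<dots> \<le> (\<integral>\<^sup>+z. indicator {x..y} z \<partial>S1.S)"
    using f by (intro nn_integral_mono_AE) (auto split: split_indicator elim!: eventually_mono)
  also have "\<dots> = emeasure S1.S {x..y}" by simp
  finally show ?thesis using S1.emeasure_S[OF xy] S2.emeasure_S[OF xy] S1.s_le[OF xy] by simp
qed

text \<open>
  Passing to \<open>s\<^sub>2\<close> may create regular end-points but destroys none, since the increments of \<open>s\<^sub>2\<close> are
  dominated by those of \<open>s\<^sub>1\<close>. So the boundary conditions for \<open>s\<^sub>2\<close> include those for \<open>s\<^sub>1\<close>.
\<close>

lemma left_regular_change_scale:
  assumes f: "AE x in S1.S. f x = 0 \<or> f x = 1" and reg: "left_regular I s1 m k"
  shows "left_regular I s2 m k"
proof -
  have left: "left_end I \<notin> ereal ` I" and ne: "I \<noteq> {}" using reg by (auto simp: left_regular_def)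
  note ev = eventually_to_left_end_iff[OF S1.I ne left]
  obtain l where "(s1 \<longlongrightarrow> l) (to_left_end I)" using reg by (auto simp: left_regular_def)
  then have "\<forall>\<^sub>F x in to_left_end I. l - 1 < s1 x" by (rule order_tendstoD) simp
  then obtain c where c: "c \<in> I" "\<And>x. x \<in> I \<Longrightarrow> x < c \<Longrightarrow> l - 1 < s1 x" unfolding ev by blast
  have "min (s2 c) (s2 c - s1 c + l - 1) \<le> s2 x" if "x \<in> I" for x
  proof (cases "x < c")
    case True
    then show ?thesis using c(2)[OF that] s2_increment_le[OF f that c(1)] by simp
  next
    case False
    then show ?thesis using S2.s_le[OF c(1) that] by simp
  qed
  then have bdd: "bdd_below (s2 ` I)" by (intro bdd_belowI2)
  have "(s2 \<longlongrightarrow> Inf (s2 ` I)) (to_left_end I)"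
  proof (rule order_tendstoI)
    fix a assume "a < Inf (s2 ` I)"
    then show "\<forall>\<^sub>F x in to_left_end I. a < s2 x"
      unfolding ev using c(1) cInf_lower[OF imageI bdd] by (meson less_le_trans)
  next
    fix a assume "Inf (s2 ` I) < a"
    then obtain d where "d \<in> I" "s2 d < a" using cInf_lessD[of "s2 ` I" a] ne by auto
    then show "\<forall>\<^sub>F x in to_left_end I. s2 x < a"
      unfolding ev using S2.s_less by (meson less_trans)
  qed
  then show ?thesis using reg by (auto simp: left_regular_def)
qed

lemma right_regular_change_scale:
  assumes f: "AE x in S1.S. f x = 0 \<or> f x = 1" and reg: "right_regular I s1 m k"
  shows "right_regular I s2 m k"
proof -
  have right: "right_end I \<notin> ereal ` I" and ne: "I \<noteq> {}" using reg by (auto simp: right_regular_def)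
  note ev = eventually_to_right_end_iff[OF S1.I ne right]
  obtain l where "(s1 \<longlongrightarrow> l) (to_right_end I)" using reg by (auto simp: right_regular_def)
  then have "\<forall>\<^sub>F x in to_right_end I. s1 x < l + 1" by (rule order_tendstoD) simp
  then obtain c where c: "c \<in> I" "\<And>x. x \<in> I \<Longrightarrow> c < x \<Longrightarrow> s1 x < l + 1" unfolding ev by blast
  have "s2 x \<le> max (s2 c) (s2 c - s1 c + l + 1)" if "x \<in> I" for x
  proof (cases "c < x")
    case True
    then show ?thesis using c(2)[OF that] s2_increment_le[OF f c(1) that] by simp
  next
    case False
    then show ?thesis using S2.s_le[OF that c(1)] by simp
  qed
  then have bdd: "bdd_above (s2 ` I)" by (intro bdd_aboveI2)
  have "(s2 \<longlongrightarrow> Sup (s2 ` I)) (to_right_end I)"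
  proof (rule order_tendstoI)
    fix a assume "a < Sup (s2 ` I)"
    then obtain d where "d \<in> I" "a < s2 d" using less_cSupD[of "s2 ` I" a] ne by auto
    then show "\<forall>\<^sub>F x in to_right_end I. a < s2 x"
      unfolding ev using S2.s_less by (meson less_trans)
  next
    fix a assume "Sup (s2 ` I) < a"
    then show "\<forall>\<^sub>F x in to_right_end I. s2 x < a"
      unfolding ev using c(1) cSup_upper[OF imageI bdd] by (meson le_less_trans)
  qed
  then show ?thesis using reg by (auto simp: right_regular_def)
qed

text \<open>
  Since \<open>f\<^sup>2 = f\<close>, the \<open>ds\<^sub>1\<close>-integral of \<open>(f g)\<^sup>2\<close> is the \<open>ds\<^sub>2\<close>-integral of \<open>g\<^sup>2\<close>.
\<close>

lemma dom0_subset: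
  assumes f: "AE x in S1.S. f x = 0 \<or> f x = 1"
  shows "dom0_smk I s2 m k \<subseteq> dom0_smk I s1 m k"
proof
  fix u assume u: "u \<in> dom0_smk I s2 m k"
  then obtain g where g: "has_ds_deriv I s2 u g" and L2: "ds_deriv I s2 u \<in> L2 S2.S"
    by (auto simp: dom0_smk_def dom_smk_def ac_wrt_def)
  note [measurable] = f_measurable S2.has_ds_deriv_measurable[OF g, unfolded measurable_S12]
  have "integrable S2.S (\<lambda>x. (g x)\<^sup>2)"
    using L2 unfolding S2.ds_deriv_in_L2_iff[OF g] by (simp add: L2_def)
  then have "integrable S1.S (\<lambda>x. f x * (g x)\<^sup>2)" by (subst (asm) integrable_S2) auto
  moreover have "AE x in S1.S. f x * (g x)\<^sup>2 = (f x * g x)\<^sup>2" using f by eventually_elim auto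
  ultimately have "integrable S1.S (\<lambda>x. (f x * g x)\<^sup>2)"
    by (subst integrable_cong_AE[symmetric]) auto
  then have "(\<lambda>x. f x * g x) \<in> L2 S1.S" by (simp add: L2_def)
  then have "ds_deriv I s1 u \<in> L2 S1.S"
    unfolding S1.ds_deriv_in_L2_iff[OF has_ds_deriv_change_scale[OF g]] .
  then show "u \<in> dom0_smk I s1 m k"
    using u has_ds_deriv_change_scale[OF g] left_regular_change_scale[OF f]
      right_regular_change_scale[OF f]
    by (auto simp: dom0_smk_def dom_smk_def ac_wrt_def)
qed

lemma form_smk_eq_of_density_0_or_1:
  assumes f: "AE x in S1.S. f x = 0 \<or> f x = 1"
    and u: "u \<in> dom0_smk I s2 m k" and v: "v \<in> dom0_smk I s2 m k"
  shows "form_smk I s1 k u v = form_smk I s2 k u v"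
proof -
  obtain g h where g: "has_ds_deriv I s2 u g" and h: "has_ds_deriv I s2 v h"
    using u v by (auto simp: dom0_smk_def dom_smk_def ac_wrt_def)
  note [measurable] = f_measurable S2.has_ds_deriv_measurable[OF g, unfolded measurable_S12]
    S2.has_ds_deriv_measurable[OF h, unfolded measurable_S12]
  have "AE x in S1.S. (f x)\<^sup>2 * (g x * h x) = f x * (g x * h x)" using f by eventually_elim auto
  then have "(\<integral>x. (f x)\<^sup>2 * (g x * h x) \<partial>S1.S) = (\<integral>x. f x * (g x * h x) \<partial>S1.S)"
    by (intro integral_cong_AE) auto
  then show ?thesis unfolding form_smk_change_scale[OF g h] by simp
qed

end

theorem theorem5p1:
  fixes I :: "real set" and m k1 k2 :: "real measure" and s1 s2 :: "real \<Rightarrow> real"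
    and E E' :: form and F F' :: "(real \<Rightarrow> real) set"
  assumes "is_interval I" and "\<exists>x\<in>I. \<exists>y\<in>I. x < y"
    and "radon_measure_on I m" and "msupport I m = I"
    and "local_irreducible_regular_dirichlet_space I m E F"
    and "local_irreducible_regular_dirichlet_space I m E' F'"
    and "strict_mono_on I s1" and "continuous_on I s1"
    and "strict_mono_on I s2" and "continuous_on I s2"
    and "radon_measure_on I k1" and "radon_measure_on I k2"
    and "represented_by E F I s1 m k1"
    and "represented_by E' F' I s2 m k2"
  shows "regular_subspace E' F' E F \<longleftrightarrow>
    k1 = k2 \<and>
    (absolutely_continuous (stieltjes I s1) (stieltjes I s2) \<and>
     (AE x in stieltjes I s1.
        RN_deriv (stieltjes I s1) (stieltjes I s2) x = 1 \<or>
        RN_deriv (stieltjes I s1) (stieltjes I s2) x = 0))"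
proof -
  let ?R = "RN_deriv (stieltjes I s1) (stieltjes I s2)"
  let ?f = "\<lambda>x. enn2real (?R x)"
  have sc: "interval_scale I s1" "interval_scale I s2"
    using assms by (auto intro: interval_scale.intro)
  have F: "F = dom0_smk I s1 m k1" "\<And>u v. u \<in> F \<Longrightarrow> v \<in> F \<Longrightarrow> E u v = form_smk I s1 k1 u v"
    and F': "F' = dom0_smk I s2 m k2" "\<And>u v. u \<in> F' \<Longrightarrow> v \<in> F' \<Longrightarrow> E' u v = form_smk I s2 k2 u v"
    using assms(13,14) by (auto simp: represented_by_def)
  show ?thesis
  proof
    assume sub: "regular_subspace E' F' E F"
    then have dom: "dom0_smk I s2 m k2 \<subseteq> dom0_smk I s1 m k1"
      using F(1) F'(1) by (simp add: regular_subspace_def)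
    have eq: "form_smk I s1 k1 u v = form_smk I s2 k2 u v"
      if "u \<in> dom0_smk I s2 m k2" "v \<in> dom0_smk I s2 m k2" for u v
    proof -
      have "u \<in> F'" "v \<in> F'" using that F'(1) by auto
      moreover have "u \<in> F" "v \<in> F" using that dom F(1) by auto
      ultimately show ?thesis using sub F(2)[of u v] F'(2)[of u v] by (simp add: regular_subspace_def)
    qed
    have ac: "absolutely_continuous (stieltjes I s1) (stieltjes I s2)"
      using absolutely_continuous_of_dom0_subset[OF sc assms(3,12) dom] .
    interpret scale_density I s1 s2 ?f by (rule scale_density_RN_deriv(1)[OF sc ac])
    have k: "k1 = k2" by (rule killing_measures_eq[OF assms(3,11,12) eq])
    have "AE x in stieltjes I s1. ?f x = 0 \<or> ?f x = 1"
      using density_0_or_1[OF assms(3,12)] eq unfolding k by blast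
    then have "AE x in stieltjes I s1. ?R x = 1 \<or> ?R x = 0"
      using scale_density_RN_deriv(2)[OF sc ac]
    proof eventually_elim
      case (elim x)
      then show ?case by (metis ennreal_0 ennreal_1)
    qed
    with k ac show "k1 = k2 \<and> (absolutely_continuous (stieltjes I s1) (stieltjes I s2) \<and>
        (AE x in stieltjes I s1. ?R x = 1 \<or> ?R x = 0))" by blast
  next
    assume R: "k1 = k2 \<and> (absolutely_continuous (stieltjes I s1) (stieltjes I s2) \<and>
        (AE x in stieltjes I s1. ?R x = 1 \<or> ?R x = 0))"
    then interpret scale_density I s1 s2 ?f by (intro scale_density_RN_deriv(1)[OF sc]) simp
    have f: "AE x in stieltjes I s1. ?f x = 0 \<or> ?f x = 1"
      using R by (auto elim!: eventually_mono)
    have dom: "F' \<subseteq> F" using dom0_subset[OF f] R F(1) F'(1) by auto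
    moreover have "E u v = E' u v" if "u \<in> F'" "v \<in> F'" for u v
    proof -
      have "form_smk I s1 k1 u v = form_smk I s2 k2 u v"
        using form_smk_eq_of_density_0_or_1[OF f, of u m k2 v] that R F'(1) by simp
      then show ?thesis using F(2)[of u v] F'(2)[of u v] that dom by auto
    qed
    ultimately show "regular_subspace E' F' E F" by (simp add: regular_subspace_def)
  qed
qed

end
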